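(* Let $F$ be a free $\mathcal{A}(1)$-module. Then $$H_{01}^{\star}(RF)\cong(F\otimes_{\mathcal{A}(1)}\mathbb{F})\otimes_{\mathbb{F}}\left(Sq^2Sq^2Sq^2\,\mathbb{F}\oplus\sigma^2Sq^1\,\mathbb{F}\right).$$ In particular, this $\mathbb{F}[a,\sigma^{-4}]$-module is concentrated in degrees of the form $\mathbb{Z}\subset RO(Q)$ and $\mathbb{Z}-2\alpha\subset RO(Q)$.
   Context: $\mathbb{F}$ is the field with two elements. $\mathcal{A}(1)$ is the subalgebra of the mod $2$ Steenrod algebra generated by $Sq^1,Sq^2$; $Q_0=Sq^1$, $Q_1=Sq^1Sq^2+Sq^2Sq^1$. $\mathcal{E}=\Lambda_{\mathbb{F}}(\mathbb{Q}_0,\mathbb{Q}_1)$ is the exterior algebra on generators of $RO(Q)$-degrees $1$ and $2+\alpha$ ($Q$ the group with two elements, $RO(Q)=\mathbb{Z}\oplus\mathbb{Z}\alpha$). $H=H\underline{\mathbb{F}}^\star_Q$, the coefficient ring of $Q$-equivariant cohomology with constant coefficients $\mathbb{F}$, has $\mathbb{F}$-basis $a^m\sigma^{-n}$ and $a^{-m}\sigma^{n+2}$ ($m,n\ge0$), $|a|=\alpha$, $|\sigma|=1-\alpha$; the first family spans $\mathbb{F}[a,\sigma^{-1}]$, which acts on the second by adding exponents (result $0$ if not of the listed form), and products of two elements of the second family vanish. $\mathcal{E}$ acts on $H$ (all exponents $k\ge0$; terms not of the listed form are $0$): $\mathbb{Q}_0(a^k\sigma^{-n})=a^{k+1}\sigma^{-n+1}$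 for $n\geq 0$ odd, $0$ for $n$ even; $\mathbb{Q}_0(a^{-k}\sigma^n)=a^{-k+1}\sigma^{n+1}$ for $n\ge2$ even, $0$ for $n$ odd; $\mathbb{Q}_1(a^k\sigma^{-n})=a^{k+3}\sigma^{-n+2}$ if $n\equiv2,3$ mod $4$, else $0$; $\mathbb{Q}_1(a^{-k}\sigma^n)=a^{-k+3}\sigma^{n+2}$ if $n\equiv2,3$ mod $4$, else $0$. The functor $R:\mathcal{A}(1)\text{-mod}\to\mathcal{E}\text{-mod}$ is $R(M)=H\otimes_{\mathbb{F}}M$ with $\mathbb{Q}_0(h\otimes x)=\mathbb{Q}_0(h)\otimes x+h\otimes Q_0x$ and $\mathbb{Q}_1(h\otimes x)=\mathbb{Q}_1(h)\otimes x+a\mathbb{Q}_0(h)\otimes Q_0x+ah\otimes Sq^2x+\sigma^{-1}h\otimes Q_1x$. For an $\mathcal{E}$-module $N$, $H_{01}^\star(N)=(\mathrm{Ker}\,\mathbb{Q}_1\cap\mathrm{Ker}\,\mathbb{Q}_0)/\mathbb{Q}_1(\mathrm{Ker}\,\mathbb{Q}_0)$; on $H_{01}^\star(RM)$ multiplication by $a$ and $\sigma^{-4}$ gives an $\mathbb{F}[a,\sigma^{-4}]$-module structure. $Sq^2Sq^2Sq^2\,\mathbb{F}$ and $\sigma^2Sq^1\,\mathbb{F}$ denote one-dimensional graded vector spaces on generators of degrees $6$ and $3-2\alpha$, corresponding to the classes of $1\otimes Sq^2Sq^2Sq^2$ and $\sigma^2\otimes Sq^1$ in $H_{01}^\star(R\mathcal{A}(1))$.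 *)

theory Defs
  imports
    Complex_Main
    "HOL-Library.Poly_Mapping"
    "HOL-Library.Z2"
    "HOL-Library.Set_Algebras"
    "HOL-Library.Product_Plus"
begin

section \<open>Vector spaces over the field with two elements, and gradings\<close>

text \<open>
  The field with two elements is \<^typ>\<open>bit\<close>.  A vector space over it is the same thing as an abelian
  group of exponent two, and linear is the same as additive; this lets vector spaces form a type class.
\<close>

class f2_space = ab_group_add +
  assumes add_self: "x + x = 0"

definition f2_scale :: "bit \<Rightarrow> 'a::f2_space \<Rightarrow> 'a" where
  "f2_scale c x = (if c = 0 then 0 else x)"

global_interpretation F2: vector_space f2_scale
proof
  fix a b :: bit and x y :: "'a::f2_space"
  show "f2_scale a (x + y) = f2_scale a x + f2_scale a y"
    by (simp add: f2_scale_def)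
  show "f2_scale (a + b) x = f2_scale a x + f2_scale b x"
    by (cases a; cases b) (auto simp: f2_scale_def add_self)
  show "f2_scale a (f2_scale b x) = f2_scale (a * b) x"
    by (auto simp: f2_scale_def)
  show "f2_scale 1 x = x"
    by (simp add: f2_scale_def)
qed

lemma f2_uminus: "- x = (x::'a::f2_space)"
  by (metis add_self minus_unique)

lemma f2_minus: "x - y = x + (y::'a::f2_space)"
  by (metis diff_conv_add_uminus f2_uminus)

lemma f2_add_left_self: "x + (x + y) = (y::'a::f2_space)"
  by (metis add_self add.assoc add.left_neutral)

instance bit :: f2_space
proof
  fix x :: bit show "x + x = 0" by (cases x) auto
qed

instance poly_mapping :: (type, f2_space) f2_space
  by standard (rule poly_mapping_eqI, simp add: lookup_add add_self)

text \<open>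
  \<^term>\<open>(p, q) :: int \<times> int\<close> stands for \<open>p + q \<alpha>\<close>.  The class \<open>graded\<close> only supplies the
  homogeneous parts \<open>gr d\<close>; that they are subspaces with direct sum the whole space is an axiom where
  modules are quantified over (class \<open>a1_module\<close> below), and for the constructions it is a consequence.
\<close>

type_synonym roq = "int \<times> int"

class graded =
  fixes gr :: "roq \<Rightarrow> 'a set"

class has_degree =
  fixes deg :: "'a \<Rightarrow> roq"

text \<open>\<^typ>\<open>'k \<Rightarrow>\<^sub>0 bit\<close> is the vector space with basis \<^typ>\<open>'k\<close>.\<close>

instantiation poly_mapping :: (has_degree, zero) graded
begin
definition gr_poly_mapping :: "roq \<Rightarrow> ('a \<Rightarrow>\<^sub>0 'b) set" where
  "gr_poly_mapping d = {p. \<forall>k \<in> Poly_Mapping.keys p. deg k = d}"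
instance ..
end

abbreviation basis :: "'k \<Rightarrow> 'k \<Rightarrow>\<^sub>0 bit" where
  "basis k \<equiv> Poly_Mapping.single k 1"

definition lin :: "('k \<Rightarrow> 'v) \<Rightarrow> ('k \<Rightarrow>\<^sub>0 bit) \<Rightarrow> 'v::f2_space" where
  "lin f p = (\<Sum>k \<in> Poly_Mapping.keys p. f2_scale (Poly_Mapping.lookup p k) (f k))"

lemma lin_superset:
  assumes "finite S" "Poly_Mapping.keys p \<subseteq> S"
  shows "lin f p = (\<Sum>k \<in> S. f2_scale (Poly_Mapping.lookup p k) (f k))"
  unfolding lin_def
  by (rule sum.mono_neutral_left) (use assms in \<open>auto simp: in_keys_iff f2_scale_def\<close>)

lemma lin_basis [simp]: "lin f (basis k) = f k"
  by (simp add: lin_def f2_scale_def)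

lemma lin_zero [simp]: "lin f 0 = 0"
  by (simp add: lin_def)

lemma lin_add: "lin f (p + q) = lin f p + lin f q"
proof -
  let ?S = "Poly_Mapping.keys p \<union> Poly_Mapping.keys q"
  have "Poly_Mapping.keys (p + q) \<subseteq> ?S" by (rule Poly_Mapping.keys_add)
  then have "lin f (p + q) = (\<Sum>k \<in> ?S. f2_scale (Poly_Mapping.lookup (p + q) k) (f k))"
    by (intro lin_superset) auto
  also have "\<dots> = (\<Sum>k \<in> ?S. f2_scale (Poly_Mapping.lookup p k) (f k)) + (\<Sum>k \<in> ?S. f2_scale (Poly_Mapping.lookup q k) (f k))"
    by (simp only: lookup_add F2.scale_left_distrib sum.distrib)
  also have "\<dots> = lin f p + lin f q"
    by (simp add: lin_superset[where S = ?S])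
  finally show ?thesis .
qed

lemma f2_poly_induct [case_names zero basis add]:
  fixes p :: "'k \<Rightarrow>\<^sub>0 bit"
  assumes "P 0" "\<And>k. P (basis k)" "\<And>p q. P p \<Longrightarrow> P q \<Longrightarrow> P (p + q)"
  shows "P p"
proof (induction "Poly_Mapping.keys p" arbitrary: p rule: infinite_finite_induct)
  case empty
  then have "p = 0" by (metis keys_eq_empty)
  then show ?case using assms(1) by simp
next
  case (insert k S)
  have "Poly_Mapping.keys (p - basis k) = S"
  proof (rule set_eqI)
    fix x
    have "x \<in> insert k S \<longleftrightarrow> Poly_Mapping.lookup p x = 1"
      using insert(4) by (simp add: in_keys_iff)
    then show "x \<in> Poly_Mapping.keys (p - basis k) \<longleftrightarrow> x \<in> S"
      using insert(2) by (auto simp: in_keys_iff lookup_minus lookup_single when_def)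
  qed
  then have "P (p - basis k)" using insert(3) by metis
  then have "P ((p - basis k) + basis k)" using assms by blast
  then show ?case by simp
qed simp

lemma additive_scale: "additive f \<Longrightarrow> f (f2_scale c x) = f2_scale c (f x)"
  by (simp add: f2_scale_def additive.zero)

lemma additive_lin: "additive (lin f)"
  by (simp add: additive_def lin_add)


section \<open>The mod 2 Steenrod algebra and \<open>\<A>(1)\<close>\<close>

datatype sq_word = Sq_word (letters: "nat list")

instantiation sq_word :: monoid_add
begin
definition zero_sq_word :: sq_word where "0 = Sq_word []"
definition plus_sq_word :: "sq_word \<Rightarrow> sq_word \<Rightarrow> sq_word" where
  "u + v = Sq_word (letters u @ letters v)"
instance
  by standard (simp_all add: zero_sq_word_def plus_sq_word_def)
end

instantiation sq_word :: has_degree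
begin
definition deg_sq_word :: "sq_word \<Rightarrow> roq" where
  "deg w = (int (sum_list (letters w)), 0)"
instance ..
end

text \<open>
  With the monoid structure above, \<^typ>\<open>sq_word \<Rightarrow>\<^sub>0 bit\<close> is the free associative algebra on symbols
  \<open>Sq\<^sup>0, Sq\<^sup>1, \<dots>\<close>.
\<close>

definition free_Sq :: "nat \<Rightarrow> sq_word \<Rightarrow>\<^sub>0 bit" where
  "free_Sq n = basis (Sq_word [n])"

definition adem_relations :: "(sq_word \<Rightarrow>\<^sub>0 bit) set" where
  "adem_relations =
     {free_Sq 0 - 1} \<union>
     {free_Sq a * free_Sq b
        - (\<Sum>j\<le>a div 2. of_nat ((b - 1 - j) choose (a - 2 * j)) * (free_Sq (a + b - j) * free_Sq j))
      | a b. 0 < a \<and> a < 2 * b}"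

definition adem_ideal :: "(sq_word \<Rightarrow>\<^sub>0 bit) set" where
  "adem_ideal = F2.span {u * r * v | u r v. r \<in> adem_relations}"

lemma adem_ideal_mult_left: "p \<in> adem_ideal \<Longrightarrow> u * p \<in> adem_ideal"
  unfolding adem_ideal_def
proof (induction p rule: F2.span_induct_alt)
  case base
  then show ?case by (simp add: F2.span_zero)
next
  case (step c x y)
  then obtain u' r v where x: "x = u' * r * v" and r: "r \<in> adem_relations" by blast
  have "u * x = (u * u') * r * v" by (simp add: x mult.assoc)
  then have ux: "u * x \<in> F2.span {u * r * v | u r v. r \<in> adem_relations}"
    using r by (intro F2.span_base) blast
  have "u * (f2_scale c x + y) = f2_scale c (u * x) + u * y"
    by (simp add: f2_scale_def distrib_left)
  then show ?case using ux step by (simp add: F2.span_add F2.span_scale)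
qed

lemma adem_ideal_mult_right: "p \<in> adem_ideal \<Longrightarrow> p * u \<in> adem_ideal"
  unfolding adem_ideal_def
proof (induction p rule: F2.span_induct_alt)
  case base
  then show ?case by (simp add: F2.span_zero)
next
  case (step c x y)
  then obtain u' r v where x: "x = u' * r * v" and r: "r \<in> adem_relations" by blast
  have "x * u = u' * r * (v * u)" by (simp add: x mult.assoc)
  then have ux: "x * u \<in> F2.span {u * r * v | u r v. r \<in> adem_relations}"
    using r by (intro F2.span_base) blast
  have "(f2_scale c x + y) * u = f2_scale c (x * u) + y * u"
    by (simp add: f2_scale_def distrib_right)
  then show ?case using ux step by (simp add: F2.span_add F2.span_scale)
qed

lemma span_equivp: "equivp (\<lambda>p q. p - q \<in> F2.span S)"
proof (rule equivpI)
  show "reflp (\<lambda>p q. p - q \<in> F2.span S)"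
    by (rule reflpI) (simp add: F2.span_zero)
  show "symp (\<lambda>p q. p - q \<in> F2.span S)"
    by (rule sympI) (simp add: f2_minus add.commute)
  show "transp (\<lambda>p q. p - q \<in> F2.span S)"
    by (rule transpI) (metis F2.span_add diff_add_cancel add_diff_eq)
qed

lemma span_equiv_add:
  assumes "p - p' \<in> F2.span S" "q - q' \<in> F2.span S"
  shows "(p + q) - (p' + q') \<in> F2.span S"
  using F2.span_add[OF assms] by (simp add: algebra_simps)

lemma span_equiv_minus:
  assumes "p - p' \<in> F2.span S" "q - q' \<in> F2.span S"
  shows "(p - q) - (p' - q') \<in> F2.span S"
  using F2.span_diff[OF assms] by (simp add: algebra_simps)

lemma span_equiv_uminus:
  assumes "p - p' \<in> F2.span S"
  shows "(- p) - (- p') \<in> F2.span S"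
  using F2.span_neg[OF assms] by (simp add: algebra_simps)

text \<open>The augmentation sends \<open>Sq\<^sup>0 = 1\<close> to \<open>1\<close> and \<open>Sq\<^sup>n\<close> to \<open>0\<close> for \<open>n > 0\<close>.\<close>

definition free_aug :: "(sq_word \<Rightarrow>\<^sub>0 bit) \<Rightarrow> bit" where
  "free_aug = lin (\<lambda>w. if set (letters w) \<subseteq> {0} then 1 else 0)"

lemma free_aug_add: "free_aug (p + q) = free_aug p + free_aug q"
  by (simp add: free_aug_def lin_add)

lemma free_aug_zero: "free_aug 0 = 0"
  by (simp add: free_aug_def)

lemma free_aug_minus: "free_aug (p - q) = free_aug p - free_aug q"
  by (simp add: f2_minus free_aug_add)

lemma free_aug_sum: "free_aug (sum f A) = (\<Sum>i\<in>A. free_aug (f i))"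
  by (induction A rule: infinite_finite_induct) (auto simp: free_aug_zero free_aug_add)

lemma basis_times: "basis u * basis v = basis (u + v)"
  by (simp add: Poly_Mapping.mult_single)

lemma free_aug_mult: "free_aug (p * q) = free_aug p * free_aug q"
proof (induction p rule: f2_poly_induct)
  case (basis u)
  show ?case
  proof (induction q rule: f2_poly_induct)
    case (basis v)
    show ?case by (auto simp: basis_times free_aug_def plus_sq_word_def)
  qed (simp_all add: free_aug_zero free_aug_add distrib_left)
qed (simp_all add: free_aug_zero free_aug_add distrib_right)

lemma free_aug_Sq: "free_aug (free_Sq n) = (if n = 0 then 1 else 0)"
  by (simp add: free_aug_def free_Sq_def)

lemma free_aug_one: "free_aug 1 = 1"
  by (simp add: free_aug_def zero_sq_word_def flip: single_one)

lemma free_aug_adem_relations: "r \<in> adem_relations \<Longrightarrow> free_aug r = 0"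
  unfolding adem_relations_def
  by (auto simp: free_aug_minus free_aug_one free_aug_Sq free_aug_mult free_aug_sum
      simp del: sum_of_bool_eq intro!: sum.neutral)

lemma free_aug_adem_ideal: "p \<in> adem_ideal \<Longrightarrow> free_aug p = 0"
  unfolding adem_ideal_def
  by (induction p rule: F2.span_induct_alt)
    (auto simp: free_aug_zero free_aug_add free_aug_mult free_aug_adem_relations f2_scale_def)

quotient_type steenrod = "sq_word \<Rightarrow>\<^sub>0 bit" / "\<lambda>p q. p - q \<in> adem_ideal"
  unfolding adem_ideal_def by (rule span_equivp)

instantiation steenrod :: ring_1
begin
lift_definition zero_steenrod :: steenrod is 0 .
lift_definition one_steenrod :: steenrod is 1 .
lift_definition plus_steenrod :: "steenrod \<Rightarrow> steenrod \<Rightarrow> steenrod" is plus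
  unfolding adem_ideal_def by (rule span_equiv_add)
lift_definition minus_steenrod :: "steenrod \<Rightarrow> steenrod \<Rightarrow> steenrod" is minus
  unfolding adem_ideal_def by (rule span_equiv_minus)
lift_definition uminus_steenrod :: "steenrod \<Rightarrow> steenrod" is uminus
  unfolding adem_ideal_def by (rule span_equiv_uminus)
lift_definition times_steenrod :: "steenrod \<Rightarrow> steenrod \<Rightarrow> steenrod" is times
proof -
  fix p p' q q' :: "sq_word \<Rightarrow>\<^sub>0 bit"
  assume 1: "p - p' \<in> adem_ideal" and 2: "q - q' \<in> adem_ideal"
  have "p * q - p' * q' = p * (q - q') + (p - p') * q'"
    by (simp add: algebra_simps)
  then show "p * q - p' * q' \<in> adem_ideal"
    using adem_ideal_mult_left[OF 2, of p] adem_ideal_mult_right[OF 1, of q']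
    unfolding adem_ideal_def by (simp add: F2.span_add)
qed

instance
proof
  show "(0::steenrod) \<noteq> 1"
  proof transfer
    have "free_aug (0 - 1) = 1"
      by (simp only: free_aug_minus free_aug_zero free_aug_one) simp
    then show "0 - 1 \<notin> adem_ideal"
      using free_aug_adem_ideal by force
  qed
qed (transfer, simp add: algebra_simps adem_ideal_def F2.span_zero)+

end

instance steenrod :: f2_space
  by standard (transfer, simp add: add_self adem_ideal_def F2.span_zero)

instantiation steenrod :: graded
begin
definition gr_steenrod :: "roq \<Rightarrow> steenrod set" where
  "gr_steenrod d = abs_steenrod ` gr d"
instance ..
end

lift_definition Sq :: "nat \<Rightarrow> steenrod" is free_Sq .

lift_definition steenrod_aug :: "steenrod \<Rightarrow> bit" is free_aug
  using free_aug_adem_ideal by (fastforce simp: free_aug_minus)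

lemma steenrod_aug_simps:
  "steenrod_aug (x + y) = steenrod_aug x + steenrod_aug y"
  "steenrod_aug (x * y) = steenrod_aug x * steenrod_aug y"
  "steenrod_aug 0 = 0" "steenrod_aug 1 = 1"
  by (transfer, simp add: free_aug_add free_aug_mult free_aug_zero free_aug_one)+

inductive_set A1_subalgebra :: "steenrod set" where
  zero: "0 \<in> A1_subalgebra"
| one: "1 \<in> A1_subalgebra"
| Sq1: "Sq 1 \<in> A1_subalgebra"
| Sq2: "Sq 2 \<in> A1_subalgebra"
| add: "x \<in> A1_subalgebra \<Longrightarrow> y \<in> A1_subalgebra \<Longrightarrow> x + y \<in> A1_subalgebra"
| mult: "x \<in> A1_subalgebra \<Longrightarrow> y \<in> A1_subalgebra \<Longrightarrow> x * y \<in> A1_subalgebra"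

typedef A1 = A1_subalgebra
  using A1_subalgebra.zero by blast

setup_lifting type_definition_A1

instantiation A1 :: ring_1
begin
lift_definition zero_A1 :: A1 is 0 by (rule A1_subalgebra.zero)
lift_definition one_A1 :: A1 is 1 by (rule A1_subalgebra.one)
lift_definition plus_A1 :: "A1 \<Rightarrow> A1 \<Rightarrow> A1" is plus by (rule A1_subalgebra.add)
lift_definition minus_A1 :: "A1 \<Rightarrow> A1 \<Rightarrow> A1" is minus
  by (simp add: f2_minus A1_subalgebra.add)
lift_definition uminus_A1 :: "A1 \<Rightarrow> A1" is uminus by (simp add: f2_uminus)
lift_definition times_A1 :: "A1 \<Rightarrow> A1 \<Rightarrow> A1" is times by (rule A1_subalgebra.mult)
instance
  by standard (transfer, simp add: algebra_simps)+
end

instance A1 :: f2_space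
  by standard (transfer, rule add_self)

instantiation A1 :: graded
begin
definition gr_A1 :: "roq \<Rightarrow> A1 set" where
  "gr_A1 d = {a. Rep_A1 a \<in> gr d}"
instance ..
end

lift_definition Sq1 :: A1 is "Sq 1" by (rule A1_subalgebra.Sq1)
lift_definition Sq2 :: A1 is "Sq 2" by (rule A1_subalgebra.Sq2)

definition Q0 :: A1 where "Q0 = Sq1"
definition Q1 :: A1 where "Q1 = Sq1 * Sq2 + Sq2 * Sq1"

lift_definition A1_aug :: "A1 \<Rightarrow> bit" is steenrod_aug .


section \<open>Graded modules over \<open>\<A>(1)\<close>\<close>

text \<open>
  A graded left module is a type of this class.  The integer grading is recorded as an \<open>RO(Q)\<close>-grading
  supported on \<open>\<int> \<subset> RO(Q)\<close>.
\<close>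

class a1_module = f2_space + graded +
  fixes act :: "A1 \<Rightarrow> 'a \<Rightarrow> 'a"  (infixr "\<bullet>" 72)
  assumes act_add_right: "a \<bullet> (x + y) = a \<bullet> x + a \<bullet> y"
    and act_add_left: "(a + b) \<bullet> x = a \<bullet> x + b \<bullet> x"
    and act_mult: "(a * b) \<bullet> x = a \<bullet> (b \<bullet> x)"
    and act_one: "1 \<bullet> x = x"
    and gr_zero: "0 \<in> gr d"
    and gr_add: "x \<in> gr d \<Longrightarrow> y \<in> gr d \<Longrightarrow> x + y \<in> gr d"
    and gr_direct_sum:
      "\<exists>!c :: roq \<Rightarrow> 'a. finite {d. c d \<noteq> 0} \<and> (\<forall>d. c d \<in> gr d) \<and> x = (\<Sum>d | c d \<noteq> 0. c d)"
    and gr_integral: "q \<noteq> 0 \<Longrightarrow> gr (p, q) = {0}"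
    and act_gr: "a \<in> gr d \<Longrightarrow> x \<in> gr e \<Longrightarrow> a \<bullet> x \<in> gr (d + e)"

definition free_a1_module :: "'m::a1_module itself \<Rightarrow> bool" where
  "free_a1_module _ \<longleftrightarrow>
     (\<exists>B :: 'm set. (\<forall>b\<in>B. \<exists>d. b \<in> gr d) \<and>
       (\<forall>x. \<exists>!c :: 'm \<Rightarrow>\<^sub>0 A1.
          Poly_Mapping.keys c \<subseteq> B \<and> x = (\<Sum>b \<in> Poly_Mapping.keys c. Poly_Mapping.lookup c b \<bullet> b)))"

lemma steenrod_aug_gr:
  assumes "a \<in> gr d" "d \<noteq> 0"
  shows "steenrod_aug a = 0"
proof -
  obtain p where a: "a = abs_steenrod p" and p: "\<forall>w\<in>Poly_Mapping.keys p. deg w = d"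
    using assms(1) by (auto simp: gr_steenrod_def gr_poly_mapping_def)
  have "\<not> set (letters w) \<subseteq> {0}" if "w \<in> Poly_Mapping.keys p" for w
  proof
    assume "set (letters w) \<subseteq> {0}"
    then have "sum_list (letters w) = 0" by auto
    then have "deg w = 0" by (simp add: deg_sq_word_def zero_prod_def)
    with that p assms(2) show False by auto
  qed
  then have "free_aug p = 0"
    by (auto simp: free_aug_def lin_def F2.scale_zero_right intro!: sum.neutral)
  then show ?thesis by (simp add: a steenrod_aug.abs_eq)
qed

instantiation bit :: a1_module
begin

definition gr_bit :: "roq \<Rightarrow> bit set" where
  "gr_bit d = (if d = 0 then UNIV else {0})"

definition act_bit :: "A1 \<Rightarrow> bit \<Rightarrow> bit" where
  "act_bit a t = A1_aug a * t"

instance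
proof
  fix a b :: A1 and x y :: bit and d e :: roq and p q :: int
  show "a \<bullet> (x + y) = a \<bullet> x + a \<bullet> y"
    unfolding act_bit_def by (rule distrib_left)
  show "(a + b) \<bullet> x = a \<bullet> x + b \<bullet> x"
    unfolding act_bit_def by transfer (simp only: steenrod_aug_simps distrib_right)
  show "(a * b) \<bullet> x = a \<bullet> (b \<bullet> x)"
    unfolding act_bit_def by transfer (simp only: steenrod_aug_simps mult.assoc)
  show "1 \<bullet> x = x"
    unfolding act_bit_def by transfer (simp add: steenrod_aug_simps)
  show "0 \<in> (gr d :: bit set)"
    by (simp add: gr_bit_def)
  show "x \<in> gr d \<Longrightarrow> y \<in> gr d \<Longrightarrow> x + y \<in> gr d"
    by (auto simp: gr_bit_def split: if_splits)
  show "q \<noteq> 0 \<Longrightarrow> gr (p, q) = {0::bit}"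
    by (simp add: gr_bit_def zero_prod_def)
  show "a \<bullet> x \<in> gr (d + e)" if "a \<in> gr d" "x \<in> gr e"
  proof (cases "d = 0")
    case True
    then show ?thesis using that by (auto simp: gr_bit_def act_bit_def split: if_splits)
  next
    case False
    then have "A1_aug a = 0" using that(1) by (simp add: A1_aug.rep_eq gr_A1_def steenrod_aug_gr)
    then show ?thesis by (simp add: act_bit_def gr_bit_def)
  qed
  show "\<exists>!c :: roq \<Rightarrow> bit. finite {d. c d \<noteq> 0} \<and> (\<forall>d. c d \<in> gr d) \<and> x = (\<Sum>d | c d \<noteq> 0. c d)"
  proof (rule ex1I[of _ "\<lambda>d. if d = 0 then x else 0"])
    have "{d :: roq. (if d = 0 then x else 0) \<noteq> 0} = (if x = 0 then {} else {0})" by auto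
    then show "finite {d :: roq. (if d = 0 then x else 0) \<noteq> 0} \<and>
        (\<forall>d. (if d = 0 then x else 0) \<in> gr d) \<and>
        x = (\<Sum>d :: roq | (if d = 0 then x else 0) \<noteq> 0. if d = 0 then x else 0)"
      by (auto simp: gr_bit_def)
  next
    fix c :: "roq \<Rightarrow> bit"
    assume c: "finite {d. c d \<noteq> 0} \<and> (\<forall>d. c d \<in> gr d) \<and> x = (\<Sum>d | c d \<noteq> 0. c d)"
    have c0: "c d = 0" if "d \<noteq> 0" for d
    proof -
      have "c d \<in> gr d" using c by blast
      then show ?thesis using that by (simp add: gr_bit_def)
    qed
    then have "{d. c d \<noteq> 0} \<subseteq> {0}" by blast
    have "x = (\<Sum>d | c d \<noteq> 0. c d)" using c by blast
    also have "\<dots> = (\<Sum>d \<in> {0}. c d)"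
      by (rule sum.mono_neutral_left) (use \<open>{d. c d \<noteq> 0} \<subseteq> {0}\<close> in auto)
    finally show "c = (\<lambda>d. if d = 0 then x else 0)"
      using c0 by auto
  qed
qed

end


section \<open>Tensor products\<close>

definition tensor_relations :: "('a::f2_space \<times> 'b::f2_space \<Rightarrow>\<^sub>0 bit) set" where
  "tensor_relations =
     {basis (x + x', y) - basis (x, y) - basis (x', y) | x x' y. True} \<union>
     {basis (x, y + y') - basis (x, y) - basis (x, y') | x y y'. True}"

quotient_type (overloaded) ('a, 'b) tensor =
  "'a::f2_space \<times> 'b::f2_space \<Rightarrow>\<^sub>0 bit" / "\<lambda>p q. p - q \<in> F2.span tensor_relations"
  by (rule span_equivp)

instantiation tensor :: (f2_space, f2_space) f2_space
begin
lift_definition zero_tensor :: "('a, 'b) tensor" is 0 .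
lift_definition plus_tensor :: "('a, 'b) tensor \<Rightarrow> ('a, 'b) tensor \<Rightarrow> ('a, 'b) tensor" is plus
  by (rule span_equiv_add)
lift_definition minus_tensor :: "('a, 'b) tensor \<Rightarrow> ('a, 'b) tensor \<Rightarrow> ('a, 'b) tensor" is minus
  by (rule span_equiv_minus)
lift_definition uminus_tensor :: "('a, 'b) tensor \<Rightarrow> ('a, 'b) tensor" is uminus
  by (rule span_equiv_uminus)
instance
  by standard (transfer, simp add: algebra_simps add_self F2.span_zero)+
end

lift_definition pure_tensor :: "'a::f2_space \<Rightarrow> 'b::f2_space \<Rightarrow> ('a, 'b) tensor"  (infixr "\<otimes>" 71)
  is "\<lambda>x y. basis (x, y)" .

instantiation tensor :: ("{f2_space, graded}", "{f2_space, graded}") graded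
begin
definition gr_tensor :: "roq \<Rightarrow> ('a, 'b) tensor set" where
  "gr_tensor d = F2.span {x \<otimes> y | x y i j. x \<in> gr i \<and> y \<in> gr j \<and> i + j = d}"
instance ..
end

definition biadditive :: "('a::f2_space \<Rightarrow> 'b::f2_space \<Rightarrow> 'c::f2_space) \<Rightarrow> bool" where
  "biadditive f \<longleftrightarrow> (\<forall>y. additive (\<lambda>x. f x y)) \<and> (\<forall>x. additive (f x))"

text \<open>
  The linear map induced by a bilinear map \<open>f\<close>; it is independent of the chosen representative by
  \<open>tensor_lift_pure\<close> and \<open>additive_tensor_lift\<close> below.
\<close>

definition tensor_lift :: "('a \<Rightarrow> 'b \<Rightarrow> 'c) \<Rightarrow> ('a::f2_space, 'b::f2_space) tensor \<Rightarrow> 'c::f2_space" where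
  "tensor_lift f t = lin (\<lambda>(x, y). f x y) (rep_tensor t)"

lemma tensor_add_left: "(x + x') \<otimes> y = x \<otimes> y + x' \<otimes> y"
proof transfer
  fix x x' :: 'a and y :: 'b
  have "basis (x + x', y) - basis (x, y) - basis (x', y) \<in> F2.span tensor_relations"
    by (rule F2.span_base) (auto simp: tensor_relations_def)
  then show "basis (x + x', y) - (basis (x, y) + basis (x', y)) \<in> F2.span tensor_relations"
    by (simp add: algebra_simps)
qed

lemma tensor_add_right: "x \<otimes> (y + y') = x \<otimes> y + x \<otimes> y'"
proof transfer
  fix x :: 'a and y y' :: 'b
  have "basis (x, y + y') - basis (x, y) - basis (x, y') \<in> F2.span tensor_relations"
    unfolding tensor_relations_def by (intro F2.span_base) blast
  then show "basis (x, y + y') - (basis (x, y) + basis (x, y')) \<in> F2.span tensor_relations"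
    by (simp add: algebra_simps)
qed

lemma tensor_zero [simp]: "0 \<otimes> y = 0" "x \<otimes> 0 = 0"
  by (metis add_cancel_left_left tensor_add_left, metis add_cancel_left_left tensor_add_right)

lemma lin_tensor_relations:
  assumes "biadditive f" "p \<in> F2.span tensor_relations"
  shows "lin (\<lambda>(x, y). f x y) p = 0"
  using assms(2)
proof (induction p rule: F2.span_induct_alt)
  case (step c r p)
  have "lin (\<lambda>(x, y). f x y) r = 0"
    using step(1) assms(1)
    by (auto simp: tensor_relations_def f2_minus lin_add biadditive_def additive_def add_self
        f2_add_left_self ac_simps)
  then show ?case
    using step by (simp add: lin_add f2_scale_def)
qed simp

lemma tensor_lift_abs:
  assumes "biadditive f"
  shows "tensor_lift f (abs_tensor p) = lin (\<lambda>(x, y). f x y) p"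
proof -
  have "rep_tensor (abs_tensor p) - p \<in> F2.span tensor_relations"
    using Quotient3_rep_abs[OF Quotient3_tensor] by (simp add: F2.span_zero)
  then have "lin (\<lambda>(x, y). f x y) (rep_tensor (abs_tensor p) + p) = 0"
    using lin_tensor_relations[OF assms] by (simp add: f2_minus)
  then show ?thesis
    unfolding tensor_lift_def lin_add by (metis f2_add_left_self add.right_neutral add.commute)
qed

lemma tensor_lift_pure [simp]: "biadditive f \<Longrightarrow> tensor_lift f (x \<otimes> y) = f x y"
  by (simp add: pure_tensor.abs_eq tensor_lift_abs)

lemma additive_tensor_lift: "biadditive f \<Longrightarrow> additive (tensor_lift f)"
  unfolding additive_def
proof (intro allI)
  fix s t :: "('a, 'b) tensor"
  assume f: "biadditive f"
  obtain p q where "s = abs_tensor p" "t = abs_tensor q"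
    by (metis Quotient3_abs_rep[OF Quotient3_tensor])
  then show "tensor_lift f (s + t) = tensor_lift f s + tensor_lift f t"
    by (simp add: plus_tensor.abs_eq tensor_lift_abs[OF f] lin_add)
qed

lemma tensor_induct [case_names zero pure add]:
  assumes "P 0" "\<And>x y. P (x \<otimes> y)" "\<And>s t. P s \<Longrightarrow> P t \<Longrightarrow> P (s + t)"
  shows "P (t :: ('a::f2_space, 'b::f2_space) tensor)"
proof -
  have "P (abs_tensor p)" for p :: "'a \<times> 'b \<Rightarrow>\<^sub>0 bit"
  proof (induction p rule: f2_poly_induct)
    case zero
    then show ?case using assms(1) by (simp add: zero_tensor_def)
  next
    case (basis k)
    then show ?case using assms(2)[of "fst k" "snd k"] by (simp add: pure_tensor.abs_eq)
  next
    case (add p q)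
    then show ?case using assms(3) by (simp flip: plus_tensor.abs_eq)
  qed
  then show ?thesis by (metis Quotient3_abs_rep[OF Quotient3_tensor])
qed

text \<open>
  \<open>M \<otimes>\<^bsub>\<A>(1)\<^esub> \<bbbF>\<close> for a left module \<open>M\<close>.  With the usual right action
  \<open>x a = \<chi>(a) x\<close>, \<open>\<chi>\<close> the conjugation, the balancing relations are \<open>\<chi>(a) x \<otimes> t = x \<otimes> a t\<close>; since
  \<open>a\<close> and \<open>\<chi>(a)\<close> act in the same way on \<open>\<bbbF>\<close> and \<open>\<chi>\<close> is bijective, they are the relations used here.
\<close>

definition balancing_relations :: "('m::a1_module, bit) tensor set" where
  "balancing_relations = {(a \<bullet> x) \<otimes> t - x \<otimes> (a \<bullet> t) | a x t. True}"

quotient_type (overloaded) 'm tensor_A1_F =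
  "('m::a1_module, bit) tensor" / "\<lambda>s t. s - t \<in> F2.span balancing_relations"
  by (rule span_equivp)

instantiation tensor_A1_F :: (a1_module) f2_space
begin
lift_definition zero_tensor_A1_F :: "'a tensor_A1_F" is 0 .
lift_definition plus_tensor_A1_F :: "'a tensor_A1_F \<Rightarrow> 'a tensor_A1_F \<Rightarrow> 'a tensor_A1_F" is plus
  by (rule span_equiv_add)
lift_definition minus_tensor_A1_F :: "'a tensor_A1_F \<Rightarrow> 'a tensor_A1_F \<Rightarrow> 'a tensor_A1_F" is minus
  by (rule span_equiv_minus)
lift_definition uminus_tensor_A1_F :: "'a tensor_A1_F \<Rightarrow> 'a tensor_A1_F" is uminus
  by (rule span_equiv_uminus)
instance
  by standard (transfer, simp add: algebra_simps add_self F2.span_zero)+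
end

instantiation tensor_A1_F :: (a1_module) graded
begin
definition gr_tensor_A1_F :: "roq \<Rightarrow> 'a tensor_A1_F set" where
  "gr_tensor_A1_F d = abs_tensor_A1_F ` gr d"
instance ..
end

lift_definition pure_A1 :: "'m::a1_module \<Rightarrow> bit \<Rightarrow> 'm tensor_A1_F"  (infixr "\<otimes>\<^sub>A" 71)
  is "\<lambda>x t. x \<otimes> t" .


section \<open>The coefficient ring \<open>H\<close>\<close>

text \<open>
  \<^term>\<open>Pos m n\<close> is \<open>a\<^sup>m \<sigma>\<^sup>-\<^sup>n\<close> and \<^term>\<open>Neg m n\<close> is \<open>a\<^sup>-\<^sup>m \<sigma>\<^sup>n\<^sup>+\<^sup>2\<close>.
\<close>

datatype H_mon = Pos nat nat | Neg nat nat

instantiation H_mon :: has_degree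
begin
fun deg_H_mon :: "H_mon \<Rightarrow> roq" where
  "deg (Pos m n) = (- int n, int m + int n)"
| "deg (Neg m n) = (int n + 2, - int m - int n - 2)"
instance ..
end

type_synonym H = "H_mon \<Rightarrow>\<^sub>0 bit"

text \<open>
  \<open>a\<^sup>i \<sigma>\<^sup>j\<close> as an element of the first, respectively of the second, family of basis elements, and
  \<open>0\<close> if it is not a member of that family.
\<close>

definition pos :: "int \<Rightarrow> int \<Rightarrow> H" where
  "pos i j = (if 0 \<le> i \<and> j \<le> 0 then basis (Pos (nat i) (nat (- j))) else 0)"

definition neg :: "int \<Rightarrow> int \<Rightarrow> H" where
  "neg i j = (if i \<le> 0 \<and> 2 \<le> j then basis (Neg (nat (- i)) (nat (j - 2))) else 0)"

text \<open>
  A product of a member of the first and a member of the second family is a member of the second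
  family or zero; thus \<open>\<sigma>\<^sup>-\<^sup>2 \<sigma>\<^sup>2 = 0\<close>, although \<open>\<sigma>\<^sup>0\<close> is a member of the first family.
\<close>

fun mon_mult :: "H_mon \<Rightarrow> H_mon \<Rightarrow> H" where
  "mon_mult (Pos m n) (Pos m' n') = pos (int m + int m') (- int n - int n')"
| "mon_mult (Pos m n) (Neg m' n') = neg (int m - int m') (int n' + 2 - int n)"
| "mon_mult (Neg m n) (Pos m' n') = neg (int m' - int m) (int n + 2 - int n')"
| "mon_mult (Neg m n) (Neg m' n') = 0"

definition H_mult :: "H \<Rightarrow> H \<Rightarrow> H"  (infixl "\<cdot>" 73) where
  "h \<cdot> h' = lin (\<lambda>u. lin (\<lambda>v. mon_mult u v) h') h"

definition H_a :: H where "H_a = pos 1 0"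

text \<open>\<open>\<sigma>\<^sup>j\<close>, with \<open>\<sigma>\<^sup>1 = 0\<close> by convention.\<close>

definition H_sigma :: "int \<Rightarrow> H" where
  "H_sigma j = (if j \<le> 0 then pos 0 j else neg 0 j)"

fun mon_Q0 :: "H_mon \<Rightarrow> H" where
  "mon_Q0 (Pos k n) = (if odd n then pos (int k + 1) (- int n + 1) else 0)"
| "mon_Q0 (Neg k l) = (let n = l + 2 in
     if even n then neg (- int k + 1) (int n + 1) else 0)"

fun mon_Q1 :: "H_mon \<Rightarrow> H" where
  "mon_Q1 (Pos k n) = (if n mod 4 \<in> {2, 3} then pos (int k + 3) (- int n + 2) else 0)"
| "mon_Q1 (Neg k l) = (let n = l + 2 in
     if n mod 4 \<in> {2, 3} then neg (- int k + 3) (int n + 2) else 0)"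

definition H_Q0 :: "H \<Rightarrow> H" where "H_Q0 = lin mon_Q0"
definition H_Q1 :: "H \<Rightarrow> H" where "H_Q1 = lin mon_Q1"


section \<open>Modules over \<open>\<E>\<close> and \<open>H\<^sub>0\<^sub>1\<close>\<close>

locale E_module =
  fixes QQ0 QQ1 :: "'n::{f2_space, graded} \<Rightarrow> 'n"
  assumes additive_QQ0: "additive QQ0"
    and additive_QQ1: "additive QQ1"
    and QQ0_QQ0: "QQ0 (QQ0 x) = 0"
    and QQ1_QQ1: "QQ1 (QQ1 x) = 0"
    and QQ0_QQ1: "QQ0 (QQ1 x) = QQ1 (QQ0 x)"
    and QQ0_gr: "x \<in> gr d \<Longrightarrow> QQ0 x \<in> gr (d + (1, 0))"
    and QQ1_gr: "x \<in> gr d \<Longrightarrow> QQ1 x \<in> gr (d + (2, 1))"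
begin

definition cycles :: "'n set" where
  "cycles = {x. QQ1 x = 0} \<inter> {x. QQ0 x = 0}"

definition boundaries :: "'n set" where
  "boundaries = QQ1 ` {x. QQ0 x = 0}"

text \<open>Elements of the quotient are cosets; their addition is the set addition of \<open>Set_Algebras\<close>.\<close>

definition hclass :: "'n \<Rightarrow> 'n set" where
  "hclass x = x +o boundaries"

definition H01 :: "'n set set" where
  "H01 = hclass ` cycles"

definition H01_gr :: "roq \<Rightarrow> 'n set set" where
  "H01_gr d = hclass ` (cycles \<inter> gr d)"

text \<open>
  The map of cosets induced by an endomorphism of the module which commutes with \<open>QQ0\<close> and \<open>QQ1\<close>.
\<close>

definition H01_map :: "('n \<Rightarrow> 'n) \<Rightarrow> 'n set \<Rightarrow> 'n set" where
  "H01_map f C = f ` C + boundaries"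

definition H01_concentrated_in :: "roq set \<Rightarrow> bool" where
  "H01_concentrated_in D \<longleftrightarrow>
     (\<forall>d. d \<notin> D \<longrightarrow> H01_gr d = {hclass 0}) \<and>
     (\<forall>C\<in>H01. \<exists>T z. finite T \<and> T \<subseteq> D \<and> (\<forall>d\<in>T. z d \<in> cycles \<inter> gr d) \<and> C = hclass (\<Sum>d\<in>T. z d))"

end


section \<open>The functor \<open>R\<close>\<close>

type_synonym 'm R = "(H, 'm) tensor"

definition R_Q0 :: "'m::a1_module R \<Rightarrow> 'm R" where
  "R_Q0 = tensor_lift (\<lambda>h x. H_Q0 h \<otimes> x + h \<otimes> Q0 \<bullet> x)"

definition R_Q1 :: "'m::a1_module R \<Rightarrow> 'm R" where
  "R_Q1 = tensor_lift (\<lambda>h x.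
     H_Q1 h \<otimes> x + (H_a \<cdot> H_Q0 h) \<otimes> Q0 \<bullet> x + (H_a \<cdot> h) \<otimes> Sq2 \<bullet> x + (H_sigma (-1) \<cdot> h) \<otimes> Q1 \<bullet> x)"

definition R_scale :: "H \<Rightarrow> 'm::a1_module R \<Rightarrow> 'm R" where
  "R_scale g = tensor_lift (\<lambda>h x. (g \<cdot> h) \<otimes> x)"


subsection \<open>\<open>R M\<close> is a module over \<open>\<E>\<close>\<close>

lemma adem_relation_zero:
  assumes "r \<in> adem_relations"
  shows "abs_steenrod r = 0"
proof -
  have "1 * r * 1 \<in> adem_ideal"
    unfolding adem_ideal_def using assms by (intro F2.span_base) blast
  then show ?thesis by (simp add: zero_steenrod_def steenrod.abs_eq_iff)
qed

lemma adem_relationI: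
  "0 < a \<Longrightarrow> a < 2 * b \<Longrightarrow>
     free_Sq a * free_Sq b
       - (\<Sum>j\<le>a div 2. of_nat ((b - 1 - j) choose (a - 2 * j)) * (free_Sq (a + b - j) * free_Sq j))
     \<in> adem_relations"
  unfolding adem_relations_def by blast

lemma adem_relations_low_degree:
  "free_Sq 0 - 1 \<in> adem_relations"
  "free_Sq 1 * free_Sq 1 \<in> adem_relations"
  "free_Sq 1 * free_Sq 2 - free_Sq 3 * free_Sq 0 \<in> adem_relations"
  "free_Sq 2 * free_Sq 2 - free_Sq 3 * free_Sq 1 \<in> adem_relations"
proof -
  show "free_Sq 0 - 1 \<in> adem_relations" by (simp add: adem_relations_def)
  show "free_Sq 1 * free_Sq 1 \<in> adem_relations"
    using adem_relationI[of 1 1] by simp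
  show "free_Sq 1 * free_Sq 2 - free_Sq 3 * free_Sq 0 \<in> adem_relations"
    using adem_relationI[of 1 2] by (simp add: eval_nat_numeral)
  have "{..Suc 0} = {0, Suc 0}" by auto
  then show "free_Sq 2 * free_Sq 2 - free_Sq 3 * free_Sq 1 \<in> adem_relations"
    using adem_relationI[of 2 2] by (simp add: eval_nat_numeral)
qed

lemma steenrod_relations:
  "Sq 0 = 1" "Sq 1 * Sq 1 = 0" "Sq 1 * Sq 2 = Sq 3" "Sq 2 * Sq 2 = Sq 3 * Sq 1"
proof -
  note relations = adem_relations_low_degree[THEN adem_relation_zero, folded
      minus_steenrod.abs_eq times_steenrod.abs_eq Sq.abs_eq one_steenrod_def zero_steenrod_def]
  show "Sq 0 = 1" "Sq 1 * Sq 1 = 0" "Sq 1 * Sq 2 = Sq 3" "Sq 2 * Sq 2 = Sq 3 * Sq 1"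
    using relations by simp_all
qed

lemma Sq1_Sq1: "Sq1 * Sq1 = 0"
  by transfer (rule steenrod_relations)

lemma Sq2_Sq2: "Sq2 * Sq2 = Sq1 * Sq2 * Sq1"
  by transfer (simp only: steenrod_relations)

lemma act_zero [simp]: "a \<bullet> 0 = (0 :: 'm::a1_module)"
  by (metis act_add_right add_cancel_left_left)

lemma zero_act [simp]: "0 \<bullet> x = (0 :: 'm::a1_module)"
  by (metis act_add_left add_cancel_left_left)

lemma A1_act_relations:
  fixes x :: "'m::a1_module"
  shows "Sq1 \<bullet> Sq1 \<bullet> x = 0"
    and "Sq2 \<bullet> Sq2 \<bullet> x = Sq1 \<bullet> Sq2 \<bullet> Sq1 \<bullet> x"
    and "Sq2 \<bullet> Sq1 \<bullet> Sq2 \<bullet> Sq1 \<bullet> x = Sq1 \<bullet> Sq2 \<bullet> Sq1 \<bullet> Sq2 \<bullet> x"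
proof -
  show *: "Sq2 \<bullet> Sq2 \<bullet> x = Sq1 \<bullet> Sq2 \<bullet> Sq1 \<bullet> x" for x :: 'm
    by (metis Sq2_Sq2 act_mult)
  show "Sq1 \<bullet> Sq1 \<bullet> x = 0"
    by (metis Sq1_Sq1 act_mult zero_act)
  show "Sq2 \<bullet> Sq1 \<bullet> Sq2 \<bullet> Sq1 \<bullet> x = Sq1 \<bullet> Sq2 \<bullet> Sq1 \<bullet> Sq2 \<bullet> x"
    using *[of "Sq2 \<bullet> x"] by (simp add: *)
qed

lemma H_mult_add_right: "g \<cdot> (h + h') = g \<cdot> h + g \<cdot> h'"
proof (induction g rule: f2_poly_induct)
  case (add p q)
  then show ?case by (simp add: H_mult_def lin_add ac_simps)
qed (simp_all add: H_mult_def lin_add)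

lemma additive_H:
  "additive (H_mult g)" "additive H_Q0" "additive H_Q1"
  by (simp_all add: additive_def H_mult_add_right H_Q0_def H_Q1_def lin_add)

lemma H_pos_basis: "H_a = basis (Pos 1 0)" "H_sigma (-1) = basis (Pos 0 1)"
  by (simp_all add: H_a_def H_sigma_def pos_def)

lemmas H_add_simps = additive.add[OF additive_H(1)] additive.add[OF additive_H(2)]
  additive.add[OF additive_H(3)]

lemmas H_zero_simps = additive.zero[OF additive_H(1)] additive.zero[OF additive_H(2)]
  additive.zero[OF additive_H(3)]

lemmas H_mon_simps = H_pos_basis H_mult_def H_Q0_def H_Q1_def pos_def neg_def Let_def
  nat_diff_distrib nat_add_distrib nat_mult_distrib mod_Suc add_self add.commute

lemma H_mon_cases:
  obtains m q where "k = Pos m (4 * q)" | m q where "k = Pos m (4 * q + 1)"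
    | m q where "k = Pos m (4 * q + 2)" | m q where "k = Pos m (4 * q + 3)"
    | m q where "k = Neg m (4 * q)" | m q where "k = Neg m (4 * q + 1)"
    | m q where "k = Neg m (4 * q + 2)" | m q where "k = Neg m (4 * q + 3)"
proof -
  have n: "\<exists>q. n = 4 * q \<or> n = 4 * q + 1 \<or> n = 4 * q + 2 \<or> n = 4 * q + (3::nat)" for n by presburger
  show thesis
  proof (cases k)
    case (Pos m n) then show ?thesis using n[of n] that by blast
  next
    case (Neg m n) then show ?thesis using n[of n] that by blast
  qed
qed

lemma H_Q0_Q0_basis: "H_Q0 (H_Q0 (basis k)) = 0"
  by (cases k rule: H_mon_cases) (auto simp: H_mon_simps)

lemma H_Q1_Q1_basis: "H_Q1 (H_Q1 (basis k)) = 0"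
  by (cases k rule: H_mon_cases) (auto simp: H_mon_simps)

lemma H_Q1_Q0_basis: "H_Q1 (H_Q0 (basis k)) = H_Q0 (H_Q1 (basis k))"
  by (cases k rule: H_mon_cases) (auto simp: H_mon_simps)

lemma H_Q0_a_basis: "H_Q0 (H_a \<cdot> (basis k)) = H_a \<cdot> H_Q0 (basis k)"
  by (cases k rule: H_mon_cases) (auto simp: H_mon_simps)

lemma H_Q1_a_basis: "H_Q1 (H_a \<cdot> (basis k)) = H_a \<cdot> H_Q1 (basis k)"
  by (cases k rule: H_mon_cases) (auto simp: H_mon_simps)

lemma H_Q0_sigma_basis: "H_Q0 (H_sigma (-1) \<cdot> (basis k)) = H_sigma (-1) \<cdot> H_Q0 (basis k) + H_a \<cdot> (basis k)"
  by (cases k rule: H_mon_cases) (auto simp: H_mon_simps)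

lemma H_Q1_sigma_basis: "H_Q1 (H_sigma (-1) \<cdot> (basis k)) = H_sigma (-1) \<cdot> H_Q1 (basis k) + H_a \<cdot> (H_a \<cdot> H_Q0 (basis k))"
  by (cases k rule: H_mon_cases) (auto simp: H_mon_simps)

lemma H_sigma_a_basis: "H_sigma (-1) \<cdot> (H_a \<cdot> (basis k)) = H_a \<cdot> (H_sigma (-1) \<cdot> (basis k))"
  by (cases k rule: H_mon_cases) (auto simp: H_mon_simps)

lemma H_relations:
  "H_Q0 (H_Q0 h) = 0"
  "H_Q1 (H_Q1 h) = 0"
  "H_Q1 (H_Q0 h) = H_Q0 (H_Q1 h)"
  "H_Q0 (H_a \<cdot> h) = H_a \<cdot> H_Q0 h"
  "H_Q1 (H_a \<cdot> h) = H_a \<cdot> H_Q1 h"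
  "H_Q0 (H_sigma (-1) \<cdot> h) = H_sigma (-1) \<cdot> H_Q0 h + H_a \<cdot> h"
  "H_Q1 (H_sigma (-1) \<cdot> h) = H_sigma (-1) \<cdot> H_Q1 h + H_a \<cdot> (H_a \<cdot> H_Q0 h)"
  "H_sigma (-1) \<cdot> (H_a \<cdot> h) = H_a \<cdot> (H_sigma (-1) \<cdot> h)"
  by (induction h rule: f2_poly_induct)
    (simp_all add: H_add_simps H_zero_simps H_Q0_Q0_basis H_Q1_Q1_basis H_Q1_Q0_basis H_Q0_a_basis
      H_Q1_a_basis H_Q0_sigma_basis H_Q1_sigma_basis H_sigma_a_basis add.assoc add.left_commute)

lemma R_biadditive:
  "biadditive (\<lambda>h (x :: 'm::a1_module). H_Q0 h \<otimes> x + h \<otimes> Q0 \<bullet> x)"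
  "biadditive (\<lambda>h (x :: 'm::a1_module). H_Q1 h \<otimes> x + (H_a \<cdot> H_Q0 h) \<otimes> Q0 \<bullet> x
     + (H_a \<cdot> h) \<otimes> Sq2 \<bullet> x + (H_sigma (-1) \<cdot> h) \<otimes> Q1 \<bullet> x)"
  "biadditive (\<lambda>h (x :: 'm::a1_module). (g \<cdot> h) \<otimes> x)"
  by (simp_all add: biadditive_def additive_def H_add_simps act_add_right
      tensor_add_left tensor_add_right ac_simps)

lemma R_pure:
  fixes x :: "'m::a1_module"
  shows "R_Q0 (h \<otimes> x) = H_Q0 h \<otimes> x + h \<otimes> Q0 \<bullet> x"
    and "R_Q1 (h \<otimes> x) = H_Q1 h \<otimes> x + (H_a \<cdot> H_Q0 h) \<otimes> Q0 \<bullet> x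
           + (H_a \<cdot> h) \<otimes> Sq2 \<bullet> x + (H_sigma (-1) \<cdot> h) \<otimes> Q1 \<bullet> x"
    and "R_scale g (h \<otimes> x) = (g \<cdot> h) \<otimes> x"
  by (simp_all add: R_Q0_def R_Q1_def R_scale_def R_biadditive)

lemma additive_R:
  "additive (R_Q0 :: 'm::a1_module R \<Rightarrow> 'm R)"
  "additive (R_Q1 :: 'm::a1_module R \<Rightarrow> 'm R)"
  "additive (R_scale g :: 'm::a1_module R \<Rightarrow> 'm R)"
  unfolding R_Q0_def R_Q1_def R_scale_def
  by (rule additive_tensor_lift, rule R_biadditive)+

lemmas R_add_simps = additive.add[OF additive_R(1)] additive.add[OF additive_R(2)]
lemmas R_zero_simps = additive.zero[OF additive_R(1)] additive.zero[OF additive_R(2)]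

lemmas R_simps = R_pure R_add_simps R_zero_simps H_relations H_add_simps
  H_zero_simps tensor_add_left tensor_add_right Q0_def Q1_def act_add_left act_add_right act_mult
  A1_act_relations add_self f2_add_left_self

lemma H_gr_subspace: "F2.subspace (gr d :: H set)"
  unfolding F2.subspace_def
proof (intro conjI ballI allI)
  show "0 \<in> (gr d :: H set)" by (simp add: gr_poly_mapping_def)
  show "x + y \<in> gr d" if "x \<in> gr d" "y \<in> gr d" for x y :: H
    using that keys_add[of x y] unfolding gr_poly_mapping_def by blast
  show "f2_scale c x \<in> gr d" if "x \<in> gr d" for c and x :: H
    using that by (simp add: f2_scale_def gr_poly_mapping_def)
qed

lemma gr_H_lin:
  assumes "p \<in> gr d" "\<And>k. f k \<in> (gr (deg k + e) :: H set)"
  shows "lin f p \<in> gr (d + e)"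
  unfolding lin_def
proof (intro F2.subspace_sum F2.subspace_scale H_gr_subspace)
  fix k assume "k \<in> Poly_Mapping.keys p"
  then have "deg k = d" using assms(1) by (simp add: gr_poly_mapping_def)
  then show "f k \<in> gr (d + e)" using assms(2) by blast
qed

lemma H_gr:
  assumes "h \<in> gr d"
  shows "H_Q0 h \<in> gr (d + (1, 0))" "H_Q1 h \<in> gr (d + (2, 1))"
    "H_a \<cdot> h \<in> gr (d + (0, 1))" "H_sigma (-1) \<cdot> h \<in> gr (d + (-1, 1))"
proof -
  have "mon_Q0 k \<in> gr (deg k + (1, 0))" for k
    by (cases k) (auto simp: gr_poly_mapping_def H_mon_simps)
  then show "H_Q0 h \<in> gr (d + (1, 0))"
    unfolding H_Q0_def using assms by (rule gr_H_lin[rotated])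
  have "mon_Q1 k \<in> gr (deg k + (2, 1))" for k
    by (cases k) (auto simp: gr_poly_mapping_def H_mon_simps)
  then show "H_Q1 h \<in> gr (d + (2, 1))"
    unfolding H_Q1_def using assms by (rule gr_H_lin[rotated])
  have "mon_mult (Pos 1 0) k \<in> gr (deg k + (0, 1))" for k
    by (cases k) (auto simp: gr_poly_mapping_def H_mon_simps)
  then show "H_a \<cdot> h \<in> gr (d + (0, 1))"
    unfolding H_mult_def H_pos_basis lin_basis using assms by (rule gr_H_lin[rotated])
  have "mon_mult (Pos 0 1) k \<in> gr (deg k + (-1, 1))" for k
    by (cases k) (auto simp: gr_poly_mapping_def H_mon_simps)
  then show "H_sigma (-1) \<cdot> h \<in> gr (d + (-1, 1))"
    unfolding H_mult_def H_pos_basis lin_basis using assms by (rule gr_H_lin[rotated])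
qed

lemma Sq_gr: "Sq1 \<in> gr (1, 0)" "Sq2 \<in> gr (2, 0)"
  by (auto simp: gr_A1_def gr_steenrod_def Sq1.rep_eq Sq2.rep_eq Sq_def free_Sq_def
      gr_poly_mapping_def deg_sq_word_def intro!: imageI)

lemma act_Q_gr:
  assumes "(x :: 'm::a1_module) \<in> gr d"
  shows "Q0 \<bullet> x \<in> gr (d + (1, 0))" "Sq2 \<bullet> x \<in> gr (d + (2, 0))" "Q1 \<bullet> x \<in> gr (d + (3, 0))"
proof -
  have 1: "Sq1 \<bullet> y \<in> gr (e + (1, 0))" and 2: "Sq2 \<bullet> y \<in> gr (e + (2, 0))" if "y \<in> gr e" for y :: 'm and e
    using act_gr[OF Sq_gr(1) that] act_gr[OF Sq_gr(2) that] by (simp_all add: add.commute)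
  show "Q0 \<bullet> x \<in> gr (d + (1, 0))" "Sq2 \<bullet> x \<in> gr (d + (2, 0))"
    using 1 2 assms by (simp_all add: Q0_def)
  show "Q1 \<bullet> x \<in> gr (d + (3, 0))"
    using 1[OF 2[OF assms]] 2[OF 1[OF assms]]
    by (simp add: Q1_def act_add_left act_mult gr_add add.assoc)
qed

lemma pure_gr: "x \<in> gr i \<Longrightarrow> y \<in> gr j \<Longrightarrow> i + j = d \<Longrightarrow> x \<otimes> y \<in> gr d"
  unfolding gr_tensor_def by (rule F2.span_base) blast

lemma tensor_gr_add: "s \<in> gr d \<Longrightarrow> t \<in> gr d \<Longrightarrow> s + t \<in> (gr d :: ('a::{f2_space,graded}, 'b::{f2_space,graded}) tensor set)"
  unfolding gr_tensor_def by (rule F2.span_add)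

lemma additive_tensor_gr:
  fixes f :: "('a::{f2_space,graded}, 'b::{f2_space,graded}) tensor \<Rightarrow> ('a, 'b) tensor"
  assumes "additive f" "t \<in> gr d"
    and "\<And>x y i j. x \<in> gr i \<Longrightarrow> y \<in> gr j \<Longrightarrow> f (x \<otimes> y) \<in> gr (i + j + e)"
  shows "f t \<in> gr (d + e)"
  using assms(2) unfolding gr_tensor_def[of d]
proof (induction t rule: F2.span_induct_alt)
  case base
  then show ?case by (simp add: additive.zero[OF assms(1)] gr_tensor_def F2.span_zero)
next
  case (step c s t)
  then have "f s \<in> gr (d + e)" using assms(3) by blast
  with step show ?case
    by (simp add: additive.add[OF assms(1)] additive_scale[OF assms(1)] gr_tensor_def F2.span_add F2.span_scale)
qed

lemma R_E_module: "E_module (R_Q0 :: 'm::a1_module R \<Rightarrow> 'm R) R_Q1"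
proof (rule E_module.intro)
  show "additive (R_Q0 :: 'm R \<Rightarrow> 'm R)" "additive (R_Q1 :: 'm R \<Rightarrow> 'm R)"
    by (rule additive_R)+
next
  fix t :: "'m R"
  show "R_Q0 (R_Q0 t) = 0"
  proof (induction t rule: tensor_induct)
    case (pure h x)
    show ?case by (simp add: R_simps ac_simps)
  qed (simp_all add: R_zero_simps R_add_simps)
  show "R_Q1 (R_Q1 t) = 0"
  proof (induction t rule: tensor_induct)
    case (pure h x)
    show ?case by (simp add: R_simps ac_simps)
  qed (simp_all add: R_zero_simps R_add_simps)
  show "R_Q0 (R_Q1 t) = R_Q1 (R_Q0 t)"
  proof (induction t rule: tensor_induct)
    case (pure h x)
    show ?case by (simp add: R_simps ac_simps)
  qed (simp_all add: R_zero_simps R_add_simps)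
next
  fix t :: "'m R" and d
  assume "t \<in> gr d"
  then show "R_Q0 t \<in> gr (d + (1, 0))"
    by (rule additive_tensor_gr[OF additive_R(1)])
      (auto simp: R_pure intro!: tensor_gr_add intro: pure_gr H_gr act_Q_gr simp: ac_simps)
  show "R_Q1 t \<in> gr (d + (2, 1))" using \<open>t \<in> gr d\<close>
  proof (rule additive_tensor_gr[OF additive_R(2)])
    fix h :: H and x :: 'm and i j assume hx: "h \<in> gr i" "x \<in> gr j"
    note h = H_gr[OF hx(1)] and x = act_Q_gr[OF hx(2)]
    have "H_Q1 h \<otimes> x \<in> gr (i + j + (2, 1))"
      by (rule pure_gr[OF h(2) hx(2)]) (simp add: ac_simps)
    moreover have "(H_a \<cdot> H_Q0 h) \<otimes> Q0 \<bullet> x \<in> gr (i + j + (2, 1))"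
      by (rule pure_gr[OF H_gr(3)[OF h(1)] x(1)]) (cases i; cases j; simp)
    moreover have "(H_a \<cdot> h) \<otimes> Sq2 \<bullet> x \<in> gr (i + j + (2, 1))"
      by (rule pure_gr[OF h(3) x(2)]) (cases i; cases j; simp)
    moreover have "(H_sigma (-1) \<cdot> h) \<otimes> Q1 \<bullet> x \<in> gr (i + j + (2, 1))"
      by (rule pure_gr[OF h(4) x(3)]) (cases i; cases j; simp)
    ultimately show "R_Q1 (h \<otimes> x) \<in> gr (i + j + (2, 1))"
      by (simp add: R_pure tensor_gr_add)
  qed
qed

global_interpretation RM: E_module "R_Q0 :: 'm::a1_module R \<Rightarrow> 'm R" R_Q1
  by (rule R_E_module)


section \<open>The graded vector space \<open>Sq\<^sup>2Sq\<^sup>2Sq\<^sup>2 \<bbbF> \<oplus> \<sigma>\<^sup>2Sq\<^sup>1 \<bbbF>\<close>\<close>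

datatype gen = Sq2Sq2Sq2 | sigma2Sq1

instantiation gen :: has_degree
begin
fun deg_gen :: "gen \<Rightarrow> roq" where
  "deg Sq2Sq2Sq2 = (6, 0)"
| "deg sigma2Sq1 = (3, -2)"
instance ..
end

type_synonym gens = "gen \<Rightarrow>\<^sub>0 bit"

end

theory Submission
  imports Defs
begin

text \<open>
  On a module over \<open>\<E>\<close> the differential \<open>Q\<^sub>1\<close> restricts to \<open>Ker Q\<^sub>0\<close>, and \<open>H\<^sub>0\<^sub>1\<close> is the homology of that
  complex.  Let \<open>F\<close> be free, \<open>V = F \<otimes>\<^bsub>\<A>(1)\<^esub> \<bbbF>\<close> and \<open>T = H \<otimes> V\<close>.  As a left module over \<open>\<Lambda>(Sq\<^sup>1)\<close>,
  \<open>\<A>(1)\<close> is free on \<open>1, Sq\<^sup>2, Sq\<^sup>2Sq\<^sup>1, Sq\<^sup>2Sq\<^sup>1Sq\<^sup>2\<close>; hence \<open>R F\<close> is free over \<open>\<Lambda>(Q\<^sub>0)\<close>, its kernel of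
  \<open>Q\<^sub>0\<close> equals the image, and this image is a sum of four copies of \<open>T\<close>, one for each of these words.
  Modulo the image of \<open>Q\<^sub>0\<close> one may replace \<open>h \<otimes> Sq\<^sup>1 x\<close> by \<open>Q\<^sub>0(h) \<otimes> x\<close>, and with \<open>s = \<sigma>\<^sup>-\<^sup>1\<close> the
  differential \<open>Q\<^sub>1\<close> becomes
  \<open>d(y\<^sub>1, y\<^sub>3, y\<^sub>4, y\<^sub>6) = (Q\<^sub>1 y\<^sub>1, Q\<^sub>1 y\<^sub>3 + s Q\<^sub>0 y\<^sub>1, Q\<^sub>1 y\<^sub>4 + s y\<^sub>1 + a Q\<^sub>0 y\<^sub>3, Q\<^sub>1 y\<^sub>6 + s y\<^sub>3 + s Q\<^sub>0 y\<^sub>4 + a y\<^sub>4)\<close>.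

  Multiplication by \<open>s\<close> is injective on the positive cone \<open>\<bbbF>[a, \<sigma>\<^sup>-\<^sup>1]\<close> with cokernel \<open>\<bbbF>[a]\<close>, and
  surjective on the negative cone with kernel the row \<open>a\<^sup>-\<^sup>k \<sigma>\<^sup>2\<close>.  Cancelling along the two terms \<open>s y\<^sub>1\<close>
  and \<open>s y\<^sub>3\<close> leaves, from the positive cone, two copies of \<open>\<bbbF>[a] \<otimes> V\<close> in the positions \<open>4\<close> and \<open>6\<close> with
  differential \<open>a\<close>, whose homology is \<open>1 \<otimes> V\<close> in position \<open>6\<close>; and, from the negative cone, two copies of
  the row \<open>a\<^sup>-\<^sup>k \<sigma>\<^sup>2\<close> in the positions \<open>1\<close> and \<open>3\<close> with the differential \<open>s Q\<^sub>0\<close>, which multiplies the row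
  by \<open>a\<close> and has homology \<open>\<sigma>\<^sup>2 \<otimes> V\<close> in position \<open>1\<close>.  This is \<open>T_homology\<close>.  The corresponding classes are
  \<open>Q\<^sub>0(1 \<otimes> Sq\<^sup>2Sq\<^sup>1Sq\<^sup>2 v) = 1 \<otimes> Sq\<^sup>2Sq\<^sup>2Sq\<^sup>2 v\<close> and \<open>Q\<^sub>0(\<sigma>\<^sup>2 \<otimes> v) = \<sigma>\<^sup>2 \<otimes> Sq\<^sup>1 v\<close>.  Their coefficients
  can be read off any cycle (\<open>gens_coeff\<close>), and a cycle with vanishing coefficients is a boundary
  (\<open>cycle_gens_boundary\<close>); the action of \<open>a\<close> and \<open>\<sigma>\<^sup>-\<^sup>4\<close>, the grading and the value on arbitrary elements of \<open>F\<close> all follow from this.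

  Coordinates on \<open>F\<close> require that the eight words spanning \<open>\<A>(1)\<close> are linearly independent in the
  Steenrod algebra.  Since \<open>\<A>(1)\<close> is a Frobenius algebra, one linear functional with value \<open>1\<close> on the
  top word and \<open>0\<close> on the other seven suffices (\<open>A1_top\<close>): the coordinates of \<open>x\<close> are the values
  of the induced map \<open>F \<rightarrow> V\<close> on the multiples of \<open>x\<close> by the dual words (\<open>A1_coordinates\<close>).
\<close>

section \<open>A functional on the Steenrod algebra detecting the top class of \<open>\<A>(1)\<close>\<close>

text \<open>
  The action of \<open>\<A>(1)\<close> on itself extends to the whole Steenrod algebra.  The eight cells are the basis
  words of \<open>\<A>(1)\<close>, named by their degrees: \<open>C3\<close> is \<open>Sq\<^sup>1Sq\<^sup>2\<close> and \<open>C3'\<close> is \<open>Sq\<^sup>2Sq\<^sup>1\<close>.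
\<close>
datatype cell = C0 | C1 | C2 | C3 | C3' | C4 | C5 | C6

text \<open>
  The Adem relation \<open>Sq\<^sup>2Sq\<^sup>3 = Sq\<^sup>5 + Sq\<^sup>4Sq\<^sup>1\<close> forces \<open>Sq\<^sup>4\<close> to map the cell of degree \<open>1\<close> to that of degree
  \<open>5\<close>.  Its values on the cells of degree \<open>0\<close> and \<open>2\<close> may be chosen, and are chosen to be zero;
  \<open>Sq\<^sup>3\<close>, \<open>Sq\<^sup>5\<close> and \<open>Sq\<^sup>6\<close> are then determined by the Adem relations.
\<close>

fun cell_Sq :: "nat \<Rightarrow> cell \<Rightarrow> (cell \<Rightarrow>\<^sub>0 bit)" where
  "cell_Sq n c = (if n = 0 then basis c else
     if (n, c) = (1, C0) then basis C1 else if (n, c) = (1, C2) then basis C3 else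
     if (n, c) = (1, C3') then basis C4 else if (n, c) = (1, C5) then basis C6 else
     if (n, c) = (2, C0) then basis C2 else if (n, c) = (2, C1) then basis C3' else
     if (n, c) = (2, C2) then basis C4 else if (n, c) = (2, C3) then basis C5 else
     if (n, c) = (2, C4) then basis C6 else
     if (n, c) = (3, C0) then basis C3 else if (n, c) = (3, C1) then basis C4 else
     if (n, c) = (3, C3) then basis C6 else
     if (n, c) = (4, C1) then basis C5 else
     if (n, c) = (5, C1) then basis C6 else
     if (n, c) = (6, C0) then basis C6 else 0)"

declare cell_Sq.simps [simp del]

definition cells_Sq :: "nat \<Rightarrow> (cell \<Rightarrow>\<^sub>0 bit) \<Rightarrow> (cell \<Rightarrow>\<^sub>0 bit)" where
  "cells_Sq n = lin (cell_Sq n)"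

lemma cells_Sq_high: "6 < a + b \<Longrightarrow> cells_Sq a (cells_Sq b (basis c)) = 0"
  by (cases c) (simp_all add: cells_Sq_def cell_Sq.simps)

definition cells_act :: "(sq_word \<Rightarrow>\<^sub>0 bit) \<Rightarrow> (cell \<Rightarrow>\<^sub>0 bit) \<Rightarrow> (cell \<Rightarrow>\<^sub>0 bit)" where
  "cells_act p v = lin (\<lambda>w. foldr cells_Sq (letters w) v) p"

lemma cells_act_add: "cells_act (p + q) v = cells_act p v + cells_act q v"
  by (simp add: cells_act_def lin_add)

lemma cells_act_basis: "cells_act (basis w) v = foldr cells_Sq (letters w) v"
  by (simp add: cells_act_def)

lemma cells_act_zero: "cells_act 0 v = 0"
  by (simp add: cells_act_def)

lemma cells_Sq_add: "cells_Sq n (v + w) = cells_Sq n v + cells_Sq n w"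
  by (simp add: cells_Sq_def lin_add)

lemma foldr_cells_Sq_add: "foldr cells_Sq ns (v + w) = foldr cells_Sq ns v + foldr cells_Sq ns w"
  by (induction ns) (simp_all add: cells_Sq_add)

lemma cells_act_add_right: "cells_act p (v + w) = cells_act p v + cells_act p w"
  by (induction p rule: f2_poly_induct)
    (simp_all add: cells_act_add cells_act_zero cells_act_basis foldr_cells_Sq_add ac_simps)

lemma cells_act_zero_right: "cells_act p 0 = 0"
  by (metis cells_act_add_right add_cancel_left_left)

lemma cells_act_mult: "cells_act (p * q) v = cells_act p (cells_act q v)"
proof (induction p rule: f2_poly_induct)
  case (basis u)
  show ?case
    by (induction q rule: f2_poly_induct)
      (simp_all add: cells_act_add cells_act_zero distrib_left cells_act_add_right cells_act_zero_right
        cells_act_basis basis_times plus_sq_word_def)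
qed (simp_all add: cells_act_add cells_act_zero distrib_right)

lemma cells_act_Sq: "cells_act (free_Sq n) v = cells_Sq n v"
  by (simp add: cells_act_def free_Sq_def)

lemma cells_act_one: "cells_act 1 v = v"
  by (simp add: cells_act_def zero_sq_word_def flip: single_one)

lemma cells_act_minus: "cells_act (p - q) v = cells_act p v - cells_act q v"
  by (simp add: f2_minus cells_act_add)

lemma cells_act_sum: "cells_act (sum f A) v = (\<Sum>i\<in>A. cells_act (f i) v)"
  by (induction A rule: infinite_finite_induct) (auto simp: cells_act_add cells_act_zero)

lemma cells_Sq_zero: "cells_Sq 0 v = v"
  unfolding cells_Sq_def
  by (induction v rule: f2_poly_induct) (simp_all add: lin_add cell_Sq.simps)

lemma of_nat_mult_f2: "of_nat k * x = (if even k then 0 else (x :: 'a::{f2_space,ring_1}))"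
  by (induction k) (auto simp: algebra_simps add_self)

text \<open>
  Both sides raise the degree by \<open>a + b\<close> and the cells have degrees between \<open>0\<close> and \<open>6\<close>, so only the ten
  pairs with \<open>a + b \<le> 6\<close> have to be inspected.
\<close>

lemma cells_adem:
  assumes "0 < a" "a < 2 * b"
  shows "cells_Sq a (cells_Sq b v) =
     (\<Sum>j\<le>a div 2. if even ((b - 1 - j) choose (a - 2 * j)) then 0 else cells_Sq (a + b - j) (cells_Sq j v))"
proof (induction v rule: f2_poly_induct)
  case (basis c)
  show ?case
  proof (cases "6 < a + b")
    case True
    have "(\<Sum>j\<le>a div 2. if even ((b - 1 - j) choose (a - 2 * j)) then 0 else cells_Sq (a + b - j) (cells_Sq j (basis c))) = 0"
      using True assms by (intro sum.neutral ballI) (simp add: cells_Sq_high)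
    then show ?thesis using True by (simp add: cells_Sq_high)
  next
    case False
    have c: "cells_Sq n (basis c) = cell_Sq n c" "cells_Sq n 0 = 0" for n c
      by (simp_all add: cells_Sq_def)
    have low: "cells_Sq 1 (cells_Sq 1 (basis c)) = 0"
      "cells_Sq 1 (cells_Sq 2 (basis c)) = cells_Sq 3 (basis c)"
      "cells_Sq 1 (cells_Sq 3 (basis c)) = 0"
      "cells_Sq 1 (cells_Sq 4 (basis c)) = cells_Sq 5 (basis c)"
      "cells_Sq 1 (cells_Sq 5 (basis c)) = 0"
      "cells_Sq 2 (cells_Sq 2 (basis c)) = cells_Sq 3 (cells_Sq 1 (basis c))"
      "cells_Sq 2 (cells_Sq 3 (basis c)) = cells_Sq 5 (basis c) + cells_Sq 4 (cells_Sq 1 (basis c))"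
      "cells_Sq 2 (cells_Sq 4 (basis c)) = cells_Sq 6 (basis c) + cells_Sq 5 (cells_Sq 1 (basis c))"
      "cells_Sq 3 (cells_Sq 2 (basis c)) = 0"
      "cells_Sq 3 (cells_Sq 3 (basis c)) = cells_Sq 5 (cells_Sq 1 (basis c))"
      by (cases c; simp add: c cell_Sq.simps add_self)+
    (* the summation ranges and the binomial coefficients that occur for these ten pairs *)
    have le1: "{..1::nat} = {0, 1}" by auto
    have ch: "(Suc 0 choose 2) = 0" "(2 choose 2) = 1" "(2::nat) choose 1 = 2" "(3::nat) choose 1 = 3"
       "(3::nat) choose 2 = 3" "(2 choose 3) = 0" "(Suc 0 choose 3) = 0"
      by (simp_all add: eval_nat_numeral)
    have "a = 1 \<and> (b = 1 \<or> b = 2 \<or> b = 3 \<or> b = 4 \<or> b = 5) \<or> a = 2 \<and> (b = 2 \<or> b = 3 \<or> b = 4) \<or>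
        a = 3 \<and> (b = 2 \<or> b = 3)"
      using assms False by presburger
    then show ?thesis
      by (elim disjE conjE; hypsubst; simp add: low low[unfolded One_nat_def] ch cells_Sq_zero le1 flip: numeral_3_eq_3)
  qed
next
  case (add v w)
  then show ?case
    by (simp add: cells_Sq_add flip: sum.distrib cong: if_cong) (rule sum.cong, auto)
next
  case zero
  have "cells_Sq n 0 = 0" for n by (simp add: cells_Sq_def)
  then show ?case by (simp cong: if_cong)
qed

lemma cells_act_of_nat: "cells_act (of_nat k) v = (if even k then 0 else v)"
  using of_nat_mult_f2[of k "1 :: sq_word \<Rightarrow>\<^sub>0 bit"] by (simp add: cells_act_zero cells_act_one)

lemma cells_act_adem_relations:
  assumes "r \<in> adem_relations"
  shows "cells_act r v = 0"
proof -
  consider "r = free_Sq 0 - 1" | a b where "0 < a" "a < 2 * b"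
    "r = free_Sq a * free_Sq b
        - (\<Sum>j\<le>a div 2. of_nat ((b - 1 - j) choose (a - 2 * j)) * (free_Sq (a + b - j) * free_Sq j))"
    using assms unfolding adem_relations_def by blast
  then show ?thesis
  proof cases
    case 1
    then show ?thesis by (simp add: cells_act_minus cells_act_Sq cells_Sq_zero cells_act_one)
  next
    case (2 a b)
    have "cells_act r v = cells_Sq a (cells_Sq b v) - (\<Sum>j\<le>a div 2.
        if even ((b - 1 - j) choose (a - 2 * j)) then 0 else cells_Sq (a + b - j) (cells_Sq j v))"
      unfolding 2(3) cells_act_minus cells_act_sum cells_act_of_nat cells_act_mult cells_act_Sq ..
    also have "\<dots> = 0"
      unfolding cells_adem[OF 2(1,2)] by (rule diff_self)
    finally show ?thesis .
  qed
qed

lemma cells_act_adem_ideal: "p \<in> adem_ideal \<Longrightarrow> cells_act p v = 0"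
  unfolding adem_ideal_def
proof (induction p rule: F2.span_induct_alt)
  case base
  show ?case by (rule cells_act_zero)
next
  case (step c x y)
  then obtain u r w where x: "x = u * r * w" and r: "r \<in> adem_relations" by blast
  have "cells_act x v = 0"
    unfolding x cells_act_mult cells_act_adem_relations[OF r] by (rule cells_act_zero_right)
  with step show ?case by (simp add: f2_scale_def cells_act_add cells_act_zero)
qed

lift_definition steenrod_top :: "steenrod \<Rightarrow> bit" is "\<lambda>p. Poly_Mapping.lookup (cells_act p (basis C0)) C6"
proof -
  fix p q :: "sq_word \<Rightarrow>\<^sub>0 bit"
  assume "p - q \<in> adem_ideal"
  then have "cells_act p (basis C0) - cells_act q (basis C0) = 0"
    using cells_act_adem_ideal cells_act_minus by metis
  then show "Poly_Mapping.lookup (cells_act p (basis C0)) C6 = Poly_Mapping.lookup (cells_act q (basis C0)) C6"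
    by simp
qed

lift_definition A1_top :: "A1 \<Rightarrow> bit" is steenrod_top .

lemma A1_top_add: "A1_top (a + b) = A1_top a + A1_top b"
proof -
  have "steenrod_top (x + y) = steenrod_top x + steenrod_top y" for x y
    by transfer (simp add: cells_act_add lookup_add)
  then show ?thesis by (simp add: A1_top.rep_eq plus_A1.rep_eq)
qed

lemma A1_top_basis:
  "A1_top 1 = 0" "A1_top Sq1 = 0" "A1_top Sq2 = 0" "A1_top (Sq1 * Sq2) = 0" "A1_top (Sq2 * Sq1) = 0"
  "A1_top (Sq1 * Sq2 * Sq1) = 0" "A1_top (Sq2 * Sq1 * Sq2) = 0" "A1_top (Sq1 * Sq2 * Sq1 * Sq2) = 1"
proof -
  note rep = A1_top.rep_eq one_A1.rep_eq times_A1.rep_eq Sq1.rep_eq Sq2.rep_eq Sq.abs_eq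
    one_steenrod_def times_steenrod.abs_eq steenrod_top.abs_eq
    cells_act_mult cells_act_Sq cells_act_one
  note val = cells_Sq_def lin_basis lin_zero cell_Sq.simps
  show "A1_top 1 = 0" unfolding rep by (simp add: val lookup_single)
  show "A1_top Sq1 = 0" unfolding rep by (simp add: val lookup_single)
  show "A1_top Sq2 = 0" unfolding rep by (simp add: val lookup_single)
  show "A1_top (Sq1 * Sq2) = 0" unfolding rep by (simp add: val lookup_single)
  show "A1_top (Sq2 * Sq1) = 0" unfolding rep by (simp add: val lookup_single)
  show "A1_top (Sq1 * Sq2 * Sq1) = 0" unfolding rep by (simp add: val lookup_single)
  show "A1_top (Sq2 * Sq1 * Sq2) = 0" unfolding rep by (simp add: val lookup_single)
  show "A1_top (Sq1 * Sq2 * Sq1 * Sq2) = 1" unfolding rep by (simp add: val lookup_single)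
qed

text \<open>
  An additive map that commutes with \<open>Sq\<^sup>1\<close> and \<open>Sq\<^sup>2\<close> is \<open>\<A>(1)\<close>-linear by this rule.
\<close>

lemma A1_induct [case_names zero one Sq1 Sq2 add mult]:
  assumes "P 0" "P 1" "P Sq1" "P Sq2" "\<And>a b. P a \<Longrightarrow> P b \<Longrightarrow> P (a + b)" "\<And>a b. P a \<Longrightarrow> P b \<Longrightarrow> P (a * b)"
  shows "P a"
proof -
  have "x \<in> A1_subalgebra \<Longrightarrow> P (Abs_A1 x)" for x
  proof (induction x rule: A1_subalgebra.induct)
    case zero
    show ?case using assms(1) unfolding zero_A1_def .
  next
    case one
    show ?case using assms(2) unfolding one_A1_def .
  next
    case Sq1
    show ?case using assms(3) unfolding Sq1_def .
  next
    case Sq2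
    show ?case using assms(4) unfolding Sq2_def .
  next
    case (add x y)
    then have "P (Abs_A1 x + Abs_A1 y)" using assms(5) by blast
    then show ?case using add(1,2) by (simp add: plus_A1.abs_eq eq_onp_def)
  next
    case (mult x y)
    then have "P (Abs_A1 x * Abs_A1 y)" using assms(6) by blast
    then show ?case using mult(1,2) by (simp add: times_A1.abs_eq eq_onp_def)
  qed
  from this[OF Rep_A1] show ?thesis by (simp add: Rep_A1_inverse)
qed

section \<open>Homogeneous components\<close>

text \<open>
  As the projection to degree \<open>d\<close> is additive, that an additive map respects degrees can be checked on
  generators: its composite with the projection is evaluated there.  This avoids writing a homogeneous
  element as a sum of generators of its own degree.
\<close>

definition degree_part :: "roq \<Rightarrow> 'm::a1_module \<Rightarrow> 'm" where
  "degree_part d x = (THE c. finite {d. c d \<noteq> 0} \<and> (\<forall>d. c d \<in> gr d) \<and> x = (\<Sum>d | c d \<noteq> 0. c d)) d"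

lemma degree_part_eqI:
  fixes x :: "'m::a1_module"
  assumes "finite S" "\<And>d. c d \<in> gr d" "\<And>d. d \<notin> S \<Longrightarrow> c d = 0" "x = sum c S"
  shows "degree_part d x = c d"
proof -
  have sub: "{d. c d \<noteq> 0} \<subseteq> S" using assms(3) by auto
  have "x = (\<Sum>d | c d \<noteq> 0. c d)"
    unfolding assms(4) by (rule sum.mono_neutral_right) (use assms(1) sub in auto)
  then have "(THE c. finite {d. c d \<noteq> 0} \<and> (\<forall>d. c d \<in> gr d) \<and> x = (\<Sum>d | c d \<noteq> 0. c d)) = c"
    using finite_subset[OF sub assms(1)] assms(2) by (intro the1_equality gr_direct_sum) auto
  then show ?thesis by (simp add: degree_part_def)
qed

lemma degree_part_spec:
  "finite {d. degree_part d x \<noteq> 0} \<and> (\<forall>d. degree_part d x \<in> gr d) \<and>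
    x = (\<Sum>d | degree_part d x \<noteq> 0. degree_part d x)"
proof -
  obtain c where c: "finite {d. c d \<noteq> 0} \<and> (\<forall>d. c d \<in> gr d) \<and> x = (\<Sum>d | c d \<noteq> 0. c d)"
    using gr_direct_sum[of x] by blast
  then have "degree_part d x = c d" for d
    by (intro degree_part_eqI[where S = "{d. c d \<noteq> 0}"]) (auto simp del: split_paired_All)
  with c show ?thesis by presburger
qed

lemma degree_part_gr: "degree_part d x \<in> gr d"
  using degree_part_spec by blast

lemma degree_part_sum:
  obtains S where "finite S" "{d. degree_part d x \<noteq> 0} \<subseteq> S" "x = (\<Sum>d\<in>S. degree_part d x)"
  using degree_part_spec[of x] by (intro that[of "{d. degree_part d x \<noteq> 0}"]) blast+

lemma degree_part_homogeneous: "x \<in> gr e \<Longrightarrow> degree_part d x = (if d = e then x else 0)"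
  by (rule degree_part_eqI[where S = "{e}"]) (auto simp: gr_zero)

lemma additive_degree_part: "additive (degree_part d)"
  unfolding additive_def
proof (intro allI)
  fix x y :: 'a
  obtain S where S: "finite S" "{d. degree_part d x \<noteq> 0} \<subseteq> S" "x = (\<Sum>d\<in>S. degree_part d x)"
    by (rule degree_part_sum[of x])
  obtain T where T: "finite T" "{d. degree_part d y \<noteq> 0} \<subseteq> T" "y = (\<Sum>d\<in>T. degree_part d y)"
    by (rule degree_part_sum[of y])
  have x: "x = (\<Sum>d\<in>S \<union> T. degree_part d x)"
    by (subst S(3), rule sum.mono_neutral_left) (use S(1,2) T(1,2) in auto)
  have y: "y = (\<Sum>d\<in>S \<union> T. degree_part d y)"
    by (subst T(3), rule sum.mono_neutral_left) (use S(1,2) T(1,2) in auto)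
  have "x + y = (\<Sum>d\<in>S \<union> T. degree_part d x + degree_part d y)"
    unfolding sum.distrib by (rule arg_cong2[where f = "(+)", OF x y])
  moreover have "degree_part e x + degree_part e y = 0" if "e \<notin> S \<union> T" for e
  proof -
    have "degree_part e x = 0" "degree_part e y = 0" using that S(2) T(2) by blast+
    then show ?thesis by simp
  qed
  ultimately show "degree_part d (x + y) = degree_part d x + degree_part d y"
    using S(1) T(1) by (intro degree_part_eqI[where S = "S \<union> T"]) (simp_all only: finite_Un gr_add degree_part_gr simp_thms)
qed

section \<open>Free modules and their reduction modulo the augmentation ideal\<close>

lemma additive_f2_scale_left: "additive (\<lambda>c. f2_scale c x)"
  by (simp only: additive_def F2.scale_left_distrib simp_thms)

definition free_basis :: "'m::a1_module set \<Rightarrow> bool" where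
  "free_basis B \<longleftrightarrow> (\<forall>b\<in>B. \<exists>d. b \<in> gr d) \<and>
     (\<forall>x. \<exists>!c :: 'm \<Rightarrow>\<^sub>0 A1.
        Poly_Mapping.keys c \<subseteq> B \<and> x = (\<Sum>b \<in> Poly_Mapping.keys c. Poly_Mapping.lookup c b \<bullet> b))"

lemma free_basis_induct [consumes 1, case_names zero act add]:
  assumes B: "free_basis B" and "P 0" "\<And>a b. b \<in> B \<Longrightarrow> P (a \<bullet> b)" "\<And>x y. P x \<Longrightarrow> P y \<Longrightarrow> P (x + y)"
  shows "P x"
proof -
  obtain c :: "'a \<Rightarrow>\<^sub>0 A1" where c: "Poly_Mapping.keys c \<subseteq> B"
      "x = (\<Sum>b \<in> Poly_Mapping.keys c. Poly_Mapping.lookup c b \<bullet> b)"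
    using B unfolding free_basis_def by blast
  have "K \<subseteq> B \<Longrightarrow> P (\<Sum>b\<in>K. Poly_Mapping.lookup c b \<bullet> b)" for K
    by (induction K rule: infinite_finite_induct) (auto intro!: assms(2-4))
  then show ?thesis using c by blast
qed

text \<open>
  Existence and uniqueness of the coefficients of \<open>x\<close>, in the form in which they are used: together with
  \<open>free_basis_induct\<close> this says that \<open>F\<close> is the direct sum of copies of \<open>\<A>(1)\<close> as an abelian group.
\<close>

lemma free_basis_extend:
  fixes f :: "A1 \<Rightarrow> 'm::a1_module \<Rightarrow> 'w::f2_space"
  assumes B: "free_basis B" and f: "\<And>b. additive (\<lambda>a. f a b)"
  shows "\<exists>g. additive g \<and> (\<forall>a. \<forall>b\<in>B. g (a \<bullet> b) = f a b)"
proof -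
  let ?spec = "\<lambda>x c. Poly_Mapping.keys c \<subseteq> B \<and> x = (\<Sum>b \<in> Poly_Mapping.keys c. Poly_Mapping.lookup c b \<bullet> b)"
  define C where "C x = (THE c. ?spec x c)" for x
  define g where "g x = (\<Sum>b \<in> Poly_Mapping.keys (C x). f (Poly_Mapping.lookup (C x) b) b)" for x
  have ex1: "\<exists>!c. ?spec x c" for x using B unfolding free_basis_def by blast
  have spec: "?spec x (C x)" for x unfolding C_def by (rule theI'[OF ex1])
  have C_eqI: "C x = c" if "?spec x c" for x c
    unfolding C_def by (rule the1_equality[OF ex1 that])
  have f0: "f 0 b = 0" for b using additive.zero[OF f] .
  have sup: "(\<Sum>b \<in> Poly_Mapping.keys c. h (Poly_Mapping.lookup c b) b) = (\<Sum>b \<in> S. h (Poly_Mapping.lookup c b) b)"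
    if "finite S" "Poly_Mapping.keys c \<subseteq> S" "\<And>b. h 0 b = 0" for S h and c :: "'m \<Rightarrow>\<^sub>0 A1" and t :: "'z::comm_monoid_add"
    by (rule sum.mono_neutral_left) (use that in \<open>auto simp: in_keys_iff\<close>)
  have "additive g"
    unfolding additive_def
  proof (intro allI)
    fix x y
    let ?S = "Poly_Mapping.keys (C x) \<union> Poly_Mapping.keys (C y)"
    have S: "finite ?S" "Poly_Mapping.keys (C x + C y) \<subseteq> ?S" using Poly_Mapping.keys_add[of "C x" "C y"] by auto
    have "x + y = (\<Sum>b\<in>?S. Poly_Mapping.lookup (C x) b \<bullet> b) + (\<Sum>b\<in>?S. Poly_Mapping.lookup (C y) b \<bullet> b)"
      using spec[of x] spec[of y] sup[of ?S "C x" "\<lambda>a b. a \<bullet> b"] sup[of ?S "C y" "\<lambda>a b. a \<bullet> b"] by simp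
    also have "\<dots> = (\<Sum>b\<in>?S. Poly_Mapping.lookup (C x + C y) b \<bullet> b)"
      by (simp add: lookup_add act_add_left sum.distrib)
    also have "\<dots> = (\<Sum>b\<in>Poly_Mapping.keys (C x + C y). Poly_Mapping.lookup (C x + C y) b \<bullet> b)"
      using sup[of ?S "C x + C y" "\<lambda>a b. a \<bullet> b"] S by simp
    finally have "C (x + y) = C x + C y"
      using spec[of x] spec[of y] S(2) by (intro C_eqI) auto
    then have "g (x + y) = (\<Sum>b\<in>?S. f (Poly_Mapping.lookup (C x + C y) b) b)"
      unfolding g_def using sup[of ?S "C x + C y" f] S f0 by simp
    also have "\<dots> = (\<Sum>b\<in>?S. f (Poly_Mapping.lookup (C x) b) b) + (\<Sum>b\<in>?S. f (Poly_Mapping.lookup (C y) b) b)"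
      by (simp add: lookup_add additive.add[OF f] sum.distrib)
    also have "\<dots> = g x + g y"
      unfolding g_def using sup[of ?S "C x" f] sup[of ?S "C y" f] f0 by simp
    finally show "g (x + y) = g x + g y" .
  qed
  moreover have "g (a \<bullet> b) = f a b" if "b \<in> B" for a b
  proof -
    have "C (a \<bullet> b) = Poly_Mapping.single b a"
      by (rule C_eqI) (use that in \<open>auto simp: lookup_single\<close>)
    then show ?thesis by (auto simp: g_def f0)
  qed
  ultimately show ?thesis by blast
qed

lemma A1_aug_simps:
  "A1_aug (a + b) = A1_aug a + A1_aug b" "A1_aug (a * b) = A1_aug a * A1_aug b"
  "A1_aug 1 = 1" "A1_aug 0 = 0" "A1_aug Sq1 = 0" "A1_aug Sq2 = 0"
  by (simp_all add: A1_aug.rep_eq plus_A1.rep_eq times_A1.rep_eq one_A1.rep_eq zero_A1.rep_eq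
      Sq1.rep_eq Sq2.rep_eq steenrod_aug_simps Sq.abs_eq steenrod_aug.abs_eq free_aug_Sq)

lemma tensor_A1_F_surj: "\<exists>x. v = x \<otimes>\<^sub>A 1"
proof -
  have "\<exists>x. abs_tensor_A1_F t = x \<otimes>\<^sub>A 1" for t :: "('a, bit) tensor"
  proof (induction t rule: tensor_induct)
    case zero
    have "abs_tensor_A1_F 0 = (0 :: 'a) \<otimes>\<^sub>A 1" by (simp add: pure_A1.abs_eq)
    then show ?case ..
  next
    case (pure x t)
    have "abs_tensor_A1_F (x \<otimes> t) = (if t = 0 then 0 else x) \<otimes>\<^sub>A 1"
      by (cases t) (simp_all add: pure_A1.abs_eq)
    then show ?case ..
  next
    case (add s t)
    then obtain x y where "abs_tensor_A1_F s = x \<otimes>\<^sub>A 1" "abs_tensor_A1_F t = y \<otimes>\<^sub>A 1" by blast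
    then have "abs_tensor_A1_F (s + t) = (x + y) \<otimes>\<^sub>A 1"
      by (simp add: pure_A1.abs_eq tensor_add_left flip: plus_tensor_A1_F.abs_eq)
    then show ?case ..
  qed
  then show ?thesis by (metis Quotient3_abs_rep[OF Quotient3_tensor_A1_F])
qed

lemma additive_pure_A1: "additive (\<lambda>x. x \<otimes>\<^sub>A t)"
  by (simp add: additive_def pure_A1.abs_eq tensor_add_left flip: plus_tensor_A1_F.abs_eq)

lemma pure_A1_zero: "x \<otimes>\<^sub>A 0 = 0"
  by (simp add: pure_A1.abs_eq zero_tensor_A1_F_def)

lemma pure_A1_balanced: "(a \<bullet> x) \<otimes>\<^sub>A 1 = f2_scale (A1_aug a) (x \<otimes>\<^sub>A 1)"
proof -
  have "(a \<bullet> x) \<otimes>\<^sub>A 1 = x \<otimes>\<^sub>A (a \<bullet> 1)"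
    by transfer (rule F2.span_base, auto simp: balancing_relations_def)
  also have "\<dots> = f2_scale (A1_aug a) (x \<otimes>\<^sub>A 1)"
    by (cases "A1_aug a") (simp_all add: act_bit_def f2_scale_def pure_A1_zero)
  finally show ?thesis .
qed

lemma tensor_A1_F_extend:
  fixes f :: "'m::a1_module \<Rightarrow> 'w::f2_space"
  assumes f: "additive f" and bal: "\<And>a x. f (a \<bullet> x) = f2_scale (A1_aug a) (f x)"
  obtains g where "additive g" "\<And>x. g (x \<otimes>\<^sub>A 1) = f x"
proof -
  let ?h = "\<lambda>x (t::bit). f2_scale t (f x)"
  have h: "biadditive ?h"
    using additive_f2_scale_left
    by (auto simp: biadditive_def additive_def[of "\<lambda>x. f2_scale _ (f x)"] additive.add[OF f] F2.scale_right_distrib)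
  note th = additive_tensor_lift[OF h]
  have zero: "tensor_lift ?h t = 0" if "t \<in> F2.span balancing_relations" for t
    using that
  proof (induction t rule: F2.span_induct_alt)
    case base
    show ?case by (rule additive.zero[OF th])
  next
    case (step c x y)
    then have "tensor_lift ?h x = 0"
      by (auto simp: balancing_relations_def additive.diff[OF th] h bal act_bit_def ac_simps)
    with step show ?case
      by (simp add: additive.add[OF th] additive_scale[OF th] F2.scale_zero_right)
  qed
  define g where "g v = tensor_lift ?h (rep_tensor_A1_F v)" for v
  have g: "g (abs_tensor_A1_F t) = tensor_lift ?h t" for t
  proof -
    have "rep_tensor_A1_F (abs_tensor_A1_F t) - t \<in> F2.span balancing_relations"
      using Quotient3_rep_abs[OF Quotient3_tensor_A1_F] by (simp add: F2.span_zero)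
    from zero[OF this] show ?thesis by (simp add: g_def additive.diff[OF th])
  qed
  have "additive g"
    unfolding additive_def
  proof (intro allI)
    fix v w :: "'m tensor_A1_F"
    obtain s t where "v = abs_tensor_A1_F s" "w = abs_tensor_A1_F t"
      by (metis Quotient3_abs_rep[OF Quotient3_tensor_A1_F])
    then show "g (v + w) = g v + g w"
      by (simp add: g plus_tensor_A1_F.abs_eq additive.add[OF th])
  qed
  moreover have "g (x \<otimes>\<^sub>A 1) = f x" for x
    by (simp add: g pure_A1.abs_eq h)
  ultimately show thesis by (rule that)
qed

lemma pure_A1_gr: "x \<in> gr d \<Longrightarrow> x \<otimes>\<^sub>A 1 \<in> gr d"
  unfolding gr_tensor_A1_F_def pure_A1.abs_eq
  by (intro imageI pure_gr[where j = 0]) (auto simp: gr_bit_def)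

lemma tensor_A1_F_gr:
  assumes "v \<in> gr d"
  obtains x where "x \<in> gr d" "v = x \<otimes>\<^sub>A 1"
proof -
  obtain t where t: "v = abs_tensor_A1_F t" "t \<in> gr d"
    using assms by (auto simp: gr_tensor_A1_F_def)
  have "\<exists>x\<in>gr d. abs_tensor_A1_F t = x \<otimes>\<^sub>A 1"
    using t(2) unfolding gr_tensor_def
  proof (induction t rule: F2.span_induct_alt)
    case base
    have "abs_tensor_A1_F 0 = (0 :: 'a) \<otimes>\<^sub>A 1" by (simp add: pure_A1.abs_eq)
    then show ?case using gr_zero by blast
  next
    case (step c s t)
    then obtain x u i j where s: "s = x \<otimes> u" "x \<in> gr i" "u \<in> gr j" "i + j = d" by blast
    obtain y where y: "y \<in> gr d" "abs_tensor_A1_F t = y \<otimes>\<^sub>A 1" using step by blast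
    let ?x = "if c = 0 \<or> u = 0 then 0 else x"
    have "?x \<in> gr d"
      using s by (auto simp: gr_zero gr_bit_def split: if_splits)
    moreover have "abs_tensor_A1_F (f2_scale c s) = ?x \<otimes>\<^sub>A 1"
      by (cases u) (auto simp: s(1) f2_scale_def pure_A1.abs_eq)
    then have "abs_tensor_A1_F (f2_scale c s + t) = (?x + y) \<otimes>\<^sub>A 1"
      using y(2) by (simp add: additive.add[OF additive_pure_A1] flip: plus_tensor_A1_F.abs_eq)
    ultimately show ?case using y(1) gr_add by blast
  qed
  with t that show thesis by blast
qed

lemma tensor_A1_F_gr_zero: "(0 :: 'm::a1_module tensor_A1_F) \<in> gr d"
  using pure_A1_gr[OF gr_zero] additive.zero[OF additive_pure_A1] by metis

lemma tensor_A1_F_gr_add: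
  fixes v w :: "'m::a1_module tensor_A1_F"
  assumes "v \<in> gr d" "w \<in> gr d"
  shows "v + w \<in> gr d"
proof -
  obtain x y where "x \<in> gr d" "y \<in> gr d" "v = x \<otimes>\<^sub>A 1" "w = y \<otimes>\<^sub>A 1"
    using tensor_A1_F_gr[OF assms(1)] tensor_A1_F_gr[OF assms(2)] by metis
  then show ?thesis
    using pure_A1_gr[OF gr_add[of x d y]] by (simp add: additive.add[OF additive_pure_A1])
qed

section \<open>Coordinates on a free module\<close>

text \<open>
  The module is a sum of eight copies of \<open>V\<close>, embedded by \<open>v \<mapsto> w \<bullet> inc v\<close> for the basis words \<open>w\<close> of
  \<open>\<A>(1)\<close>.  Only the coordinate at the top word \<open>Sq\<^sup>1Sq\<^sup>2Sq\<^sup>1Sq\<^sup>2 = Sq\<^sup>2Sq\<^sup>2Sq\<^sup>2\<close> is recorded.  The pairing of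
  two words by the top coefficient of their product is perfect and makes each word dual to exactly one
  word: \<open>1\<close> to the top word, \<open>Sq\<^sup>1\<close> to \<open>Sq\<^sup>2Sq\<^sup>1Sq\<^sup>2\<close>, \<open>Sq\<^sup>2\<close> to \<open>Sq\<^sup>1Sq\<^sup>2Sq\<^sup>1\<close>, and the two words of degree
  \<open>3\<close> each to itself.  The coordinate at a word is therefore the top coordinate after acting by its dual.
\<close>

locale A1_coordinates =
  fixes inc :: "'v::{f2_space,graded} \<Rightarrow> 'm::a1_module" and top_coord :: "'m \<Rightarrow> 'v"
  assumes additive_inc: "additive inc"
    and additive_top_coord: "additive top_coord"
    and decompose: "x = inc (top_coord (Sq1 \<bullet> Sq2 \<bullet> Sq1 \<bullet> Sq2 \<bullet> x)) + Sq1 \<bullet> inc (top_coord (Sq2 \<bullet> Sq1 \<bullet> Sq2 \<bullet> x))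
      + Sq2 \<bullet> inc (top_coord (Sq1 \<bullet> Sq2 \<bullet> Sq1 \<bullet> x)) + Sq1 \<bullet> Sq2 \<bullet> inc (top_coord (Sq1 \<bullet> Sq2 \<bullet> x))
      + Sq2 \<bullet> Sq1 \<bullet> inc (top_coord (Sq2 \<bullet> Sq1 \<bullet> x)) + Sq1 \<bullet> Sq2 \<bullet> Sq1 \<bullet> inc (top_coord (Sq2 \<bullet> x))
      + Sq2 \<bullet> Sq1 \<bullet> Sq2 \<bullet> inc (top_coord (Sq1 \<bullet> x)) + Sq1 \<bullet> Sq2 \<bullet> Sq1 \<bullet> Sq2 \<bullet> inc (top_coord x)"
    and top_coord_inc: "top_coord (inc v) = 0" "top_coord (Sq1 \<bullet> inc v) = 0" "top_coord (Sq2 \<bullet> inc v) = 0"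
      "top_coord (Sq1 \<bullet> Sq2 \<bullet> inc v) = 0" "top_coord (Sq2 \<bullet> Sq1 \<bullet> inc v) = 0"
      "top_coord (Sq1 \<bullet> Sq2 \<bullet> Sq1 \<bullet> inc v) = 0" "top_coord (Sq2 \<bullet> Sq1 \<bullet> Sq2 \<bullet> inc v) = 0"
      "top_coord (Sq1 \<bullet> Sq2 \<bullet> Sq1 \<bullet> Sq2 \<bullet> inc v) = v"
    and inc_gr: "v \<in> gr d \<Longrightarrow> inc v \<in> gr d"
    and top_coord_gr: "x \<in> gr d \<Longrightarrow> top_coord x \<in> gr (d - (6, 0))"

text \<open>
  For a basis \<open>B\<close>, \<open>inc\<close> sends the class of \<open>b\<close> back to \<open>b\<close>, and \<open>top_coord\<close> sends \<open>a \<bullet> b\<close> to the class of \<open>b\<close>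
  scaled by \<open>A1_top a\<close>.  The decomposition holds because its right-hand side is compatible with \<open>Sq\<^sup>1\<close> and
  \<open>Sq\<^sup>2\<close> by the relations in \<open>\<A>(1)\<close>, hence with all of \<open>\<A>(1)\<close>, and is correct on \<open>B\<close>.
\<close>

lemma free_coordinates:
  fixes B :: "'m::a1_module set"
  assumes B: "free_basis B"
  obtains inc :: "'m::a1_module tensor_A1_F \<Rightarrow> 'm" and top_coord where "A1_coordinates inc top_coord" "\<forall>v. inc v \<otimes>\<^sub>A 1 = v"
proof -
  have add: "additive (\<lambda>a. f2_scale (A1_aug a) b)" "additive (\<lambda>a. f2_scale (A1_top a) v)"
    for b :: 'm and v :: "'m tensor_A1_F"
    by (simp_all only: additive_def A1_aug_simps A1_top_add F2.scale_left_distrib simp_thms)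
  obtain aug :: "'m \<Rightarrow> 'm" where
    aug: "additive aug" "\<And>a b. b \<in> B \<Longrightarrow> aug (a \<bullet> b) = f2_scale (A1_aug a) b"
    using free_basis_extend[OF B, of "\<lambda>a b. f2_scale (A1_aug a) b", OF add(1)] by blast
  have "aug (a \<bullet> x) = f2_scale (A1_aug a) (aug x)" for a x
    using B
  proof (induction x rule: free_basis_induct)
    case (act a' b)
    then show ?case by (simp add: aug(2) A1_aug_simps flip: act_mult)
  qed (simp_all add: additive.zero[OF aug(1)] additive.add[OF aug(1)] act_add_right F2.scale_right_distrib F2.scale_zero_right)
  then obtain inc where inc: "additive inc" "\<And>x. inc (x \<otimes>\<^sub>A 1) = aug x"
    using tensor_A1_F_extend[OF aug(1)] by metis
  obtain top_coord :: "'m \<Rightarrow> 'm tensor_A1_F" where top_coord: "additive top_coord"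
      "\<And>a b. b \<in> B \<Longrightarrow> top_coord (a \<bullet> b) = f2_scale (A1_top a) (b \<otimes>\<^sub>A 1)"
    using free_basis_extend[OF B, of "\<lambda>a b. f2_scale (A1_top a) (b \<otimes>\<^sub>A 1)", OF add(2)] by blast
  note adds = act_add_right additive.add[OF inc(1)] additive.add[OF top_coord(1)]
  note zeros = additive.zero[OF inc(1)] additive.zero[OF top_coord(1)]
  have aug_class: "aug x \<otimes>\<^sub>A 1 = x \<otimes>\<^sub>A 1" for x
    using B
  proof (induction x rule: free_basis_induct)
    case (act a b)
    then show ?case
      by (simp add: aug(2) pure_A1_balanced additive_scale[OF additive_pure_A1])
  qed (simp_all add: additive.zero[OF aug(1)] additive.add[OF aug(1)] additive.add[OF additive_pure_A1])
  have inc_class: "inc v \<otimes>\<^sub>A 1 = v" for v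
    using tensor_A1_F_surj[of v] by (auto simp: inc aug_class)
  have aug_b: "aug b = b" if "b \<in> B" for b
    using aug(2)[OF that, of 1] by (simp add: act_one A1_aug_simps)
  have V_induct: "P v" if "P 0" "\<And>b. b \<in> B \<Longrightarrow> P (b \<otimes>\<^sub>A 1)" "\<And>v w. P v \<Longrightarrow> P w \<Longrightarrow> P (v + w)" for P v
  proof -
    have "P (x \<otimes>\<^sub>A 1)" for x
      using B
    proof (induction x rule: free_basis_induct)
      case zero
      then show ?case using that(1) additive.zero[OF additive_pure_A1] by metis
    next
      case (act a b)
      then show ?case using that(1,2) by (simp add: pure_A1_balanced f2_scale_def)
    next
      case (add x y)
      then show ?case using that(3) by (simp add: additive.add[OF additive_pure_A1])
    qed
    then show ?thesis using tensor_A1_F_surj[of v] by metis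
  qed
  note top_vals = A1_top_basis[unfolded mult.assoc]
  have top_coord_inc: "top_coord (a \<bullet> inc v) = f2_scale (A1_top a) v" for a v
    by (induction v rule: V_induct) (simp_all add: zeros adds inc(2) aug_b top_coord(2) F2.scale_right_distrib F2.scale_zero_right)
  define N where "N x = inc (top_coord (Sq1 \<bullet> Sq2 \<bullet> Sq1 \<bullet> Sq2 \<bullet> x)) + Sq1 \<bullet> inc (top_coord (Sq2 \<bullet> Sq1 \<bullet> Sq2 \<bullet> x))
      + Sq2 \<bullet> inc (top_coord (Sq1 \<bullet> Sq2 \<bullet> Sq1 \<bullet> x)) + Sq1 \<bullet> Sq2 \<bullet> inc (top_coord (Sq1 \<bullet> Sq2 \<bullet> x))
      + Sq2 \<bullet> Sq1 \<bullet> inc (top_coord (Sq2 \<bullet> Sq1 \<bullet> x)) + Sq1 \<bullet> Sq2 \<bullet> Sq1 \<bullet> inc (top_coord (Sq2 \<bullet> x))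
      + Sq2 \<bullet> Sq1 \<bullet> Sq2 \<bullet> inc (top_coord (Sq1 \<bullet> x)) + Sq1 \<bullet> Sq2 \<bullet> Sq1 \<bullet> Sq2 \<bullet> inc (top_coord x)" for x
  have N_add: "N (x + y) = N x + N y" for x y
    by (simp add: N_def adds ac_simps)
  have N_zero: "N 0 = 0"
    by (simp add: N_def zeros)
  have N_act: "N (a \<bullet> x) = a \<bullet> N x" for a x
  proof (induction a arbitrary: x rule: A1_induct)
    case Sq1
    show ?case by (simp add: N_def adds zeros A1_act_relations ac_simps)
  next
    case Sq2
    show ?case by (simp add: N_def adds zeros A1_act_relations ac_simps)
  next
    case zero
    show ?case by (simp add: N_def zeros)
  qed (simp_all add: act_one act_add_left N_add act_mult)
  have N_basis: "N b = b" if "b \<in> B" for b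
  proof -
    have t: "top_coord (a \<bullet> b) = f2_scale (A1_top a) (b \<otimes>\<^sub>A 1)" for a by (rule top_coord(2)[OF that])
    have i: "inc (b \<otimes>\<^sub>A 1) = b" using that by (simp add: inc aug_b)
    show ?thesis
      using t[of 1] t[of Sq1] t[of Sq2]
      by (simp add: N_def t i top_vals act_one zeros F2.scale_zero_left f2_scale_def flip: act_mult)
  qed
  have N: "N x = x" for x
    using B
    by (induction x rule: free_basis_induct) (simp_all add: N_act N_basis N_add N_zero)
  define words :: "(A1 \<times> int) set" where
    "words = {(1, 0), (Sq1, 1), (Sq2, 2), (Sq1 * Sq2, 3), (Sq2 * Sq1, 3), (Sq1 * (Sq2 * Sq1), 4),
      (Sq2 * (Sq1 * Sq2), 5), (Sq1 * (Sq2 * (Sq1 * Sq2)), 6)}"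
  have words_induct: "P x"
    if "P 0" "\<And>w k b. (w, k) \<in> words \<Longrightarrow> b \<in> B \<Longrightarrow> P (w \<bullet> b)" "\<And>x y. P x \<Longrightarrow> P y \<Longrightarrow> P (x + y)" for P x
  proof -
    have w: "P (w \<bullet> inc v)" if "(w, k) \<in> words" for w k v
      by (induction v rule: V_induct) (use that \<open>P 0\<close> \<open>\<And>w k b. (w, k) \<in> words \<Longrightarrow> b \<in> B \<Longrightarrow> P (w \<bullet> b)\<close>
        \<open>\<And>x y. P x \<Longrightarrow> P y \<Longrightarrow> P (x + y)\<close> in \<open>auto simp: zeros adds inc(2) aug_b\<close>)
    have w': "P (inc v)" "P (Sq1 \<bullet> inc v)" "P (Sq2 \<bullet> inc v)" "P (Sq1 \<bullet> Sq2 \<bullet> inc v)" "P (Sq2 \<bullet> Sq1 \<bullet> inc v)"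
      "P (Sq1 \<bullet> Sq2 \<bullet> Sq1 \<bullet> inc v)" "P (Sq2 \<bullet> Sq1 \<bullet> Sq2 \<bullet> inc v)" "P (Sq1 \<bullet> Sq2 \<bullet> Sq1 \<bullet> Sq2 \<bullet> inc v)" for v
      using w[of 1 0 v] w[of Sq1 1 v] w[of Sq2 2 v] w[of "Sq1 * Sq2" 3 v] w[of "Sq2 * Sq1" 3 v]
        w[of "Sq1 * (Sq2 * Sq1)" 4 v] w[of "Sq2 * (Sq1 * Sq2)" 5 v]
        w[of "Sq1 * (Sq2 * (Sq1 * Sq2))" 6 v]
      by (simp_all add: words_def act_mult act_one)
    have "P (N x)"
      unfolding N_def by (intro that(3) w')
    then show ?thesis by (simp add: N)
  qed
  have words_gr: "w \<bullet> x \<in> gr (e + (k, 0))" if "(w, k) \<in> words" "x \<in> gr e" for w k e and x :: 'm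
  proof -
    have 1: "Sq1 \<bullet> y \<in> gr (e + (j + 1, 0))" "Sq2 \<bullet> y \<in> gr (e + (j + 2, 0))" if "y \<in> gr (e + (j, 0))" for y :: 'm and e j
      using act_Q_gr[OF that] by (simp_all add: Q0_def add.assoc)
    have 0: "x \<in> gr (e + (0, 0))" using that(2) by (simp flip: zero_prod_def)
    note 2 = 1[OF 0]
    show ?thesis
      using that(1) 0 2 2[THEN 1(1)] 2[THEN 1(2)] 2[THEN 1(1), THEN 1(2)]  2[THEN 1(2), THEN 1(1)]
        2[THEN 1(2), THEN 1(1), THEN 1(2)]  2[THEN 1(1), THEN 1(2), THEN 1(1)]
      by (auto simp: words_def act_mult act_one)
  qed
  have words_aug: "A1_aug w = (if k = 0 then 1 else 0)" "A1_top w = (if k = 6 then 1 else 0)" if "(w, k) \<in> words" for w k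
    using that by (auto simp: words_def A1_aug_simps top_vals)
  have "A1_coordinates inc top_coord"
  proof (rule A1_coordinates.intro)
    show "additive inc" "additive top_coord" by (rule inc top_coord)+
    show "x = inc (top_coord (Sq1 \<bullet> Sq2 \<bullet> Sq1 \<bullet> Sq2 \<bullet> x)) + Sq1 \<bullet> inc (top_coord (Sq2 \<bullet> Sq1 \<bullet> Sq2 \<bullet> x))
      + Sq2 \<bullet> inc (top_coord (Sq1 \<bullet> Sq2 \<bullet> Sq1 \<bullet> x)) + Sq1 \<bullet> Sq2 \<bullet> inc (top_coord (Sq1 \<bullet> Sq2 \<bullet> x))
      + Sq2 \<bullet> Sq1 \<bullet> inc (top_coord (Sq2 \<bullet> Sq1 \<bullet> x)) + Sq1 \<bullet> Sq2 \<bullet> Sq1 \<bullet> inc (top_coord (Sq2 \<bullet> x))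
      + Sq2 \<bullet> Sq1 \<bullet> Sq2 \<bullet> inc (top_coord (Sq1 \<bullet> x)) + Sq1 \<bullet> Sq2 \<bullet> Sq1 \<bullet> Sq2 \<bullet> inc (top_coord x)" for x
      using N[of x] by (simp add: N_def)
    fix v
    show "top_coord (inc v) = 0" using top_coord_inc[of 1] by (simp add: act_one top_vals)
    show "top_coord (Sq1 \<bullet> inc v) = 0" "top_coord (Sq2 \<bullet> inc v) = 0"
      "top_coord (Sq1 \<bullet> Sq2 \<bullet> inc v) = 0" "top_coord (Sq2 \<bullet> Sq1 \<bullet> inc v) = 0"
      "top_coord (Sq1 \<bullet> Sq2 \<bullet> Sq1 \<bullet> inc v) = 0" "top_coord (Sq2 \<bullet> Sq1 \<bullet> Sq2 \<bullet> inc v) = 0"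
      "top_coord (Sq1 \<bullet> Sq2 \<bullet> Sq1 \<bullet> Sq2 \<bullet> inc v) = v"
      by (simp_all add: top_coord_inc top_vals f2_scale_def flip: act_mult)
  next
    fix v :: "'m tensor_A1_F" and d assume "v \<in> gr d"
    then obtain x where x: "x \<in> gr d" "v = x \<otimes>\<^sub>A 1" by (rule tensor_A1_F_gr)
    have "aug (degree_part d y) \<in> gr d" for y
    proof (induction y rule: words_induct)
      case (2 w k b)
      then obtain e where e: "b \<in> gr e" using B unfolding free_basis_def by blast
      show ?case
        using e aug(2)[OF 2(2)] words_aug[OF 2(1)]
        by (auto simp: degree_part_homogeneous[OF words_gr[OF 2(1) e]] additive.zero[OF aug(1)] gr_zero f2_scale_def
            simp flip: zero_prod_def)
    qed (simp_all add: additive.zero[OF additive_degree_part] additive.add[OF additive_degree_part]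
        additive.zero[OF aug(1)] additive.add[OF aug(1)] gr_zero gr_add)
    from this[of x] show "inc v \<in> gr d" using x by (simp add: inc degree_part_homogeneous)
  next
    fix x :: 'm and d assume "x \<in> gr d"
    have "top_coord (degree_part d y) \<in> gr (d - (6, 0))" for y
    proof (induction y rule: words_induct)
      case (2 w k b)
      then obtain e where e: "b \<in> gr e" using B unfolding free_basis_def by blast
      show ?case
        using pure_A1_gr[OF e] top_coord(2)[OF 2(2)] words_aug[OF 2(1)]
        by (auto simp: degree_part_homogeneous[OF words_gr[OF 2(1) e]] zeros tensor_A1_F_gr_zero f2_scale_def)
    qed (simp_all add: additive.zero[OF additive_degree_part] additive.add[OF additive_degree_part]
        zeros adds tensor_A1_F_gr_zero tensor_A1_F_gr_add)
    from this[of x] show "top_coord x \<in> gr (d - (6, 0))" using \<open>x \<in> gr d\<close> by (simp add: degree_part_homogeneous)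
  qed
  then show thesis using inc_class by (intro that allI)
qed

section \<open>Classes in \<open>H\<^sub>0\<^sub>1\<close>\<close>

context E_module
begin

lemma boundaries_zero: "0 \<in> boundaries"
  unfolding boundaries_def
  by (intro image_eqI[where x = 0]) (simp_all add: additive.zero additive_QQ0 additive_QQ1)

lemma boundaries_add: "x \<in> boundaries \<Longrightarrow> y \<in> boundaries \<Longrightarrow> x + y \<in> boundaries"
proof -
  assume "x \<in> boundaries" "y \<in> boundaries"
  then obtain u v where "QQ0 u = 0" "x = QQ1 u" "QQ0 v = 0" "y = QQ1 v" by (auto simp: boundaries_def)
  then have "QQ0 (u + v) = 0" "x + y = QQ1 (u + v)"
    by (simp_all add: additive.add[OF additive_QQ0] additive.add[OF additive_QQ1])
  then show ?thesis unfolding boundaries_def by blast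
qed

lemma hclass_eq_iff: "hclass x = hclass y \<longleftrightarrow> x + y \<in> boundaries"
proof
  assume "hclass x = hclass y"
  then have "x + 0 \<in> y +o boundaries"
    using boundaries_zero unfolding hclass_def by (metis set_plus_intro2)
  then obtain b where "b \<in> boundaries" "x = y + b" by (auto simp: elt_set_plus_def)
  then show "x + y \<in> boundaries" by (metis add.commute f2_add_left_self)
next
  assume b: "x + y \<in> boundaries"
  have "u +o boundaries \<subseteq> v +o boundaries" if "u + v \<in> boundaries" for u v
  proof
    fix z assume "z \<in> u +o boundaries"
    then obtain c where c: "c \<in> boundaries" "z = u + c" by (auto simp: elt_set_plus_def)
    have "z = v + ((u + v) + c)" using c(2) by (simp add: ac_simps f2_add_left_self add_self)
    then show "z \<in> v +o boundaries" using boundaries_add[OF that c(1)] by (auto simp: elt_set_plus_def)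
  qed
  from this[of x y] this[of y x] b show "hclass x = hclass y" by (auto simp: hclass_def add.commute)
qed

lemma hclass_add: "hclass (x + y) = hclass x + hclass y"
proof
  show "hclass (x + y) \<subseteq> hclass x + hclass y"
  proof
    fix z assume "z \<in> hclass (x + y)"
    then obtain b where "b \<in> boundaries" "z = (x + 0) + (y + b)" by (auto simp: hclass_def elt_set_plus_def ac_simps)
    then show "z \<in> hclass x + hclass y"
      using boundaries_zero unfolding hclass_def by (metis set_plus_intro set_plus_intro2)
  qed
  show "hclass x + hclass y \<subseteq> hclass (x + y)"
    using boundaries_add by (auto simp: hclass_def elt_set_plus_def ac_simps elim!: set_plus_elim)
qed

lemma H01_map_hclass:
  assumes "additive f" "\<And>x. f (QQ0 x) = QQ0 (f x)" "\<And>x. f (QQ1 x) = QQ1 (f x)"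
  shows "H01_map f (hclass z) = hclass (f z)"
proof -
  have b: "f b \<in> boundaries" if b: "b \<in> boundaries" for b
  proof -
    obtain x where "b = QQ1 x" "QQ0 x = 0" using b by (auto simp: boundaries_def)
    then have "f b = QQ1 (f x)" "QQ0 (f x) = 0" using assms(2)[of x] assms(3)[of x] additive.zero[OF assms(1)] by simp_all
    then show ?thesis by (auto simp: boundaries_def)
  qed
  have "f ` (z +o boundaries) + boundaries = f z +o boundaries"
  proof
    show "f ` (z +o boundaries) + boundaries \<subseteq> f z +o boundaries"
      using b boundaries_add by (auto simp: elt_set_plus_def additive.add[OF assms(1)] add.assoc elim!: set_plus_elim)
    show "f z +o boundaries \<subseteq> f ` (z +o boundaries) + boundaries"
    proof
      fix y assume "y \<in> f z +o boundaries"
      then obtain c where c: "c \<in> boundaries" "y = f z + c" by (auto simp: elt_set_plus_def)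
      have "f z \<in> f ` (z +o boundaries)"
        using set_plus_intro2[OF boundaries_zero, of z] by simp
      then show "y \<in> f ` (z +o boundaries) + boundaries" using c by auto
    qed
  qed
  then show ?thesis by (simp add: H01_map_def hclass_def)
qed

end

section \<open>Division by \<open>a\<close> and by \<open>\<sigma>\<^sup>-\<^sup>1\<close> in the coefficients\<close>

definition tensor_map :: "('a \<Rightarrow> 'c) \<Rightarrow> ('b \<Rightarrow> 'd) \<Rightarrow> ('a::f2_space, 'b::f2_space) tensor \<Rightarrow> ('c::f2_space, 'd::f2_space) tensor" where
  "tensor_map f g = tensor_lift (\<lambda>x y. f x \<otimes> g y)"

lemma biadditive_tensor_map:
  "additive f \<Longrightarrow> additive g \<Longrightarrow> biadditive (\<lambda>x y. f x \<otimes> g y)"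
  by (simp add: biadditive_def additive_def tensor_add_left tensor_add_right)

lemma tensor_map_pure: "additive f \<Longrightarrow> additive g \<Longrightarrow> tensor_map f g (x \<otimes> y) = f x \<otimes> g y"
  by (simp add: tensor_map_def biadditive_tensor_map)

lemma additive_tensor_map: "additive f \<Longrightarrow> additive g \<Longrightarrow> additive (tensor_map f g)"
  unfolding tensor_map_def by (intro additive_tensor_lift biadditive_tensor_map)

text \<open>
  Exponents are lowered where a monomial is divisible, and a monomial of the positive cone that is not
  divisible goes to \<open>0\<close>; in the negative cone every monomial is divisible.
\<close>

fun mon_div_a :: "H_mon \<Rightarrow> H" where
  "mon_div_a (Pos 0 n) = 0"
| "mon_div_a (Pos (Suc m) n) = basis (Pos m n)"
| "mon_div_a (Neg m n) = basis (Neg (Suc m) n)"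

fun mon_div_s :: "H_mon \<Rightarrow> H" where
  "mon_div_s (Pos m 0) = 0"
| "mon_div_s (Pos m (Suc n)) = basis (Pos m n)"
| "mon_div_s (Neg m n) = basis (Neg m (Suc n))"

definition H_div_a :: "H \<Rightarrow> H" where "H_div_a = lin mon_div_a"
definition H_div_s :: "H \<Rightarrow> H" where "H_div_s = lin mon_div_s"

text \<open>
  \<open>s = \<sigma>\<^sup>-\<^sup>1\<close> followed or preceded by its division differs from the identity by two projections:
  \<open>H_coker_s\<close> projects to \<open>\<bbbF>[a]\<close>, a complement of the image of \<open>s\<close>, and \<open>H_ker_s\<close> to the row of
  the \<open>a\<^sup>-\<^sup>k \<sigma>\<^sup>2\<close>, which is the kernel of \<open>s\<close>.
\<close>

definition H_coker_s :: "H \<Rightarrow> H" where "H_coker_s h = h + H_sigma (-1) \<cdot> H_div_s h"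
definition H_ker_s :: "H \<Rightarrow> H" where "H_ker_s h = h + H_div_s (H_sigma (-1) \<cdot> h)"

definition H_proj :: "H_mon \<Rightarrow> H \<Rightarrow> H" where
  "H_proj k h = f2_scale (Poly_Mapping.lookup h k) (basis k)"

lemma additive_H_ops: "additive H_div_a" "additive H_div_s" "additive H_coker_s" "additive H_ker_s" "additive (H_proj k)"
proof -
  show 1: "additive H_div_a" "additive H_div_s" by (simp_all add: H_div_a_def H_div_s_def additive_lin)
  show "additive H_coker_s" "additive H_ker_s"
    by (simp_all add: additive_def H_coker_s_def H_ker_s_def H_add_simps additive.add[OF 1(2)] ac_simps)
  show "additive (H_proj k)"
    unfolding additive_def H_proj_def lookup_add by (simp only: F2.scale_left_distrib simp_thms)
qed

lemma additive_comp: "additive f \<Longrightarrow> additive g \<Longrightarrow> additive (\<lambda>x. f (g x))"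
  by (simp add: additive_def)

lemmas H_ops_add = H_add_simps additive_H_ops[THEN additive.add]
lemmas H_ops_zero = H_zero_simps additive_H_ops[THEN additive.zero]

lemma H_a_mon: "H_a \<cdot> basis (Pos m n) = basis (Pos (Suc m) n)"
  "H_a \<cdot> basis (Neg (Suc m) n) = basis (Neg m n)" "H_a \<cdot> basis (Neg 0 n) = 0"
  by (simp_all add: H_mon_simps)

lemma H_s_mon: "H_sigma (-1) \<cdot> basis (Pos m n) = basis (Pos m (Suc n))"
  "H_sigma (-1) \<cdot> basis (Neg m (Suc n)) = basis (Neg m n)" "H_sigma (-1) \<cdot> basis (Neg m 0) = 0"
  by (simp_all add: H_mon_simps)

lemma H_div_mon: "H_div_a (basis k) = mon_div_a k" "H_div_s (basis k) = mon_div_s k"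
  by (simp_all add: H_div_a_def H_div_s_def)

lemma H_coker_s_mon: "H_coker_s (basis (Pos m n)) = (if n = 0 then basis (Pos m n) else 0)" "H_coker_s (basis (Neg m n)) = 0"
  by (cases n; simp add: H_coker_s_def H_div_mon H_s_mon H_ops_zero add_self)+

lemma H_ker_s_mon: "H_ker_s (basis (Neg m n)) = (if n = 0 then basis (Neg m n) else 0)" "H_ker_s (basis (Pos m n)) = 0"
  by (cases n; simp add: H_ker_s_def H_div_mon H_s_mon H_ops_zero add_self)+

lemma H_proj_mon: "H_proj k (basis l) = (if k = l then basis k else 0)"
  by (simp add: H_proj_def lookup_single f2_scale_def)

lemma H_Q_mon: "H_Q0 (basis (Pos m 0)) = 0" "H_Q1 (basis (Pos m 0)) = 0"
   "H_Q0 (basis (Neg 0 0)) = 0" "H_Q0 (basis (Neg (Suc m) 0)) = basis (Neg m 1)"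
  by (simp_all add: H_mon_simps)

lemmas H_mon_eval = H_a_mon H_s_mon H_div_mon H_coker_s_mon H_ker_s_mon H_proj_mon H_Q_mon H_ops_zero add_self

lemma H_mon_suc_cases:
  obtains "k = Pos 0 0" | m where "k = Pos (Suc m) 0" | n where "k = Pos 0 (Suc n)"
    | m n where "k = Pos (Suc m) (Suc n)"
    | "k = Neg 0 0" | m where "k = Neg (Suc m) 0" | n where "k = Neg 0 (Suc n)"
    | m n where "k = Neg (Suc m) (Suc n)"
  by (metis H_mon.exhaust nat.exhaust)

text \<open>
  These identities drive the elimination in \<open>T_homology\<close>: \<open>Q\<^sub>0\<close> and \<open>Q\<^sub>1\<close> vanish on \<open>\<bbbF>[a]\<close>; division by \<open>a\<close> inverts \<open>a\<close> on \<open>\<bbbF>[a]\<close> up to the coefficient of \<open>1\<close>, and inverts \<open>s Q\<^sub>0\<close>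
  on the row \<open>a\<^sup>-\<^sup>k \<sigma>\<^sup>2\<close> up to the coefficient of \<open>\<sigma>\<^sup>2\<close>, because there \<open>s Q\<^sub>0\<close> is multiplication by \<open>a\<close>.
\<close>

lemma H_division_basis:
  "H_coker_s (H_sigma (-1) \<cdot> basis k) = 0"
  "H_sigma (-1) \<cdot> H_ker_s (basis k) = 0"
  "H_Q0 (H_coker_s (basis k)) = 0"
  "H_Q1 (H_coker_s (basis k)) = 0"
  "H_coker_s (H_coker_s (basis k)) = H_coker_s (basis k)"
  "H_coker_s (H_a \<cdot> H_coker_s (basis k)) = H_a \<cdot> H_coker_s (basis k)"
  "H_div_a (H_a \<cdot> H_coker_s (basis k)) = H_coker_s (basis k)"
  "H_coker_s (H_div_a (H_coker_s (basis k))) = H_div_a (H_coker_s (basis k))"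
  "H_a \<cdot> H_div_a (H_coker_s (basis k)) = H_coker_s (basis k) + H_proj (Pos 0 0) (H_coker_s (basis k))"
  "H_sigma (-1) \<cdot> H_div_a (H_ker_s (basis k)) = 0"
  "H_sigma (-1) \<cdot> H_Q0 (H_div_a (H_ker_s (basis k))) = H_ker_s (basis k)"
  "H_div_a (H_sigma (-1) \<cdot> H_Q0 (H_ker_s (basis k))) = H_ker_s (basis k) + H_proj (Neg 0 0) (H_ker_s (basis k))"
  "H_proj (Pos 0 0) (H_sigma (-1) \<cdot> basis k) = 0"
  "H_proj (Pos 0 0) (H_a \<cdot> basis k) = 0"
  by (cases k rule: H_mon_suc_cases; simp add: H_mon_eval)+

lemma H_proj_Q1_basis: "H_proj (Pos 0 0) (H_Q1 (basis k)) = 0" "H_proj (Neg 0 0) (H_Q1 (basis k)) = 0"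
  by (cases k; simp add: H_Q1_def pos_def neg_def Let_def H_proj_mon H_ops_zero)+

lemma H_division:
  "H_coker_s (H_sigma (-1) \<cdot> h) = 0"
  "H_sigma (-1) \<cdot> H_ker_s h = 0"
  "H_Q0 (H_coker_s h) = 0"
  "H_Q1 (H_coker_s h) = 0"
  "H_coker_s (H_coker_s h) = H_coker_s h"
  "H_coker_s (H_a \<cdot> H_coker_s h) = H_a \<cdot> H_coker_s h"
  "H_div_a (H_a \<cdot> H_coker_s h) = H_coker_s h"
  "H_coker_s (H_div_a (H_coker_s h)) = H_div_a (H_coker_s h)"
  "H_a \<cdot> H_div_a (H_coker_s h) = H_coker_s h + H_proj (Pos 0 0) (H_coker_s h)"
  "H_sigma (-1) \<cdot> H_div_a (H_ker_s h) = 0"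
  "H_sigma (-1) \<cdot> H_Q0 (H_div_a (H_ker_s h)) = H_ker_s h"
  "H_div_a (H_sigma (-1) \<cdot> H_Q0 (H_ker_s h)) = H_ker_s h + H_proj (Neg 0 0) (H_ker_s h)"
  "H_proj (Pos 0 0) (H_sigma (-1) \<cdot> h) = 0"
  "H_proj (Pos 0 0) (H_a \<cdot> h) = 0"
  "H_proj (Pos 0 0) (H_Q1 h) = 0"
  "H_proj (Neg 0 0) (H_Q1 h) = 0"
  by (induction h rule: f2_poly_induct; simp only: H_division_basis H_proj_Q1_basis H_ops_add H_ops_zero add_0_left ac_simps)+

section \<open>The reduced complex and its homology\<close>

definition on_H :: "(H \<Rightarrow> H) \<Rightarrow> (H, 'v::f2_space) tensor \<Rightarrow> (H, 'v) tensor" where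
  "on_H f = tensor_map f (\<lambda>v. v)"

lemma additive_id: "additive (\<lambda>x. x)"
  by (simp add: additive_def)

lemma on_H_pure: "additive f \<Longrightarrow> on_H f (h \<otimes> v) = f h \<otimes> v"
  by (simp add: on_H_def tensor_map_pure additive_id)

lemma additive_on_H: "additive f \<Longrightarrow> additive (on_H f)"
  by (simp add: on_H_def additive_tensor_map additive_id)

abbreviation "a_T \<equiv> on_H (H_mult H_a)"
abbreviation "s_T \<equiv> on_H (H_mult (H_sigma (-1)))"
abbreviation "Q0_T \<equiv> on_H H_Q0"
abbreviation "Q1_T \<equiv> on_H H_Q1"
abbreviation "div_a_T \<equiv> on_H H_div_a"
abbreviation "div_s_T \<equiv> on_H H_div_s"
abbreviation "coker_T \<equiv> on_H H_coker_s"
abbreviation "ker_T \<equiv> on_H H_ker_s"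
abbreviation "proj_T k \<equiv> on_H (H_proj k)"

lemmas T_add = additive_H[THEN additive_on_H, THEN additive.add] additive_H_ops[THEN additive_on_H, THEN additive.add]
lemmas T_zero = additive_H[THEN additive_on_H, THEN additive.zero] additive_H_ops[THEN additive_on_H, THEN additive.zero]
lemmas T_pure = additive_H[THEN on_H_pure] additive_H_ops[THEN on_H_pure]

lemma coker_T_eq: "coker_T t = t + s_T (div_s_T t)" and ker_T_eq: "ker_T t = t + div_s_T (s_T t)"
proof -
  show "coker_T t = t + s_T (div_s_T t)"
  proof (induction t rule: tensor_induct)
    case (pure h v)
    show ?case by (simp only: T_pure H_coker_s_def[of h] tensor_add_left)
  qed (simp_all only: T_zero T_add add_0_left ac_simps)
  show "ker_T t = t + div_s_T (s_T t)"
  proof (induction t rule: tensor_induct)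
    case (pure h v)
    show ?case by (simp only: T_pure H_ker_s_def[of h] tensor_add_left)
  qed (simp_all only: T_zero T_add add_0_left ac_simps)
qed

lemma T_division:
  "coker_T (s_T t) = 0"
  "s_T (ker_T t) = 0"
  "Q0_T (coker_T t) = 0"
  "Q1_T (coker_T t) = 0"
  "coker_T (coker_T t) = coker_T t"
  "coker_T (a_T (coker_T t)) = a_T (coker_T t)"
  "div_a_T (a_T (coker_T t)) = coker_T t"
  "coker_T (div_a_T (coker_T t)) = div_a_T (coker_T t)"
  "a_T (div_a_T (coker_T t)) = coker_T t + proj_T (Pos 0 0) (coker_T t)"
  "s_T (div_a_T (ker_T t)) = 0"
  "s_T (Q0_T (div_a_T (ker_T t))) = ker_T t"
  "div_a_T (s_T (Q0_T (ker_T t))) = ker_T t + proj_T (Neg 0 0) (ker_T t)"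
  by (induction t rule: tensor_induct;
      simp only: T_pure T_add T_zero H_division tensor_add_left tensor_zero add_0_left ac_simps)+

lemma T_relations:
  "Q0_T (Q0_T t) = 0"
  "Q1_T (Q1_T t) = 0"
  "Q1_T (Q0_T t) = Q0_T (Q1_T t)"
  "Q0_T (a_T t) = a_T (Q0_T t)"
  "Q1_T (a_T t) = a_T (Q1_T t)"
  "Q0_T (s_T t) = s_T (Q0_T t) + a_T t"
  "Q1_T (s_T t) = s_T (Q1_T t) + a_T (a_T (Q0_T t))"
  "s_T (a_T t) = a_T (s_T t)"
  by (induction t rule: tensor_induct;
      simp only: T_pure T_add T_zero H_relations tensor_add_left tensor_zero add_0_left ac_simps)+

definition T_coeff :: "H_mon \<Rightarrow> (H, 'v::f2_space) tensor \<Rightarrow> 'v" where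
  "T_coeff k = tensor_lift (\<lambda>h v. f2_scale (Poly_Mapping.lookup h k) v)"

lemma biadditive_coeff: "biadditive (\<lambda>h (v :: 'v::f2_space). f2_scale (Poly_Mapping.lookup (h :: H) k) v)"
  unfolding biadditive_def additive_def lookup_add
  by (simp only: F2.scale_left_distrib F2.scale_right_distrib simp_thms)

lemma T_coeff_pure: "T_coeff k (h \<otimes> v) = f2_scale (Poly_Mapping.lookup h k) v"
  by (simp add: T_coeff_def biadditive_coeff)

lemma additive_T_coeff: "additive (T_coeff k)"
  unfolding T_coeff_def by (rule additive_tensor_lift, rule biadditive_coeff)

lemma proj_T_eq: "proj_T k t = basis k \<otimes> T_coeff k t"
proof (induction t rule: tensor_induct)
  case (pure h v)
  show ?case by (simp add: T_pure H_proj_def[of k h] T_coeff_pure f2_scale_def)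
qed (simp_all add: T_zero additive.zero[OF additive_T_coeff] T_add additive.add[OF additive_T_coeff] tensor_add_right)

lemma T_coeff_zero:
  assumes "additive f" "\<And>h. H_proj k (f h) = 0"
  shows "T_coeff k (on_H f t) = 0"
proof (induction t rule: tensor_induct)
  case (pure h v)
  have "Poly_Mapping.lookup (H_proj k (f h)) k = 0" by (simp add: assms(2))
  then have "Poly_Mapping.lookup (f h) k = 0" by (simp add: H_proj_def f2_scale_def split: if_splits)
  then show ?case by (simp add: on_H_pure assms(1) T_coeff_pure f2_scale_def)
qed (simp_all add: additive.zero[OF additive_T_coeff] additive.add[OF additive_T_coeff]
    additive.zero[OF additive_on_H[OF assms(1)]] additive.add[OF additive_on_H[OF assms(1)]])

text \<open>
  The entries of a quadruple are indexed by \<open>1, 3, 4, 6\<close>, the degrees of the words \<open>Sq\<^sup>1 w\<close> with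
  \<open>w\<close> one of \<open>1, Sq\<^sup>2, Sq\<^sup>2Sq\<^sup>1, Sq\<^sup>2Sq\<^sup>1Sq\<^sup>2\<close>.
\<close>

type_synonym 'v T4 = "(H, 'v) tensor \<times> (H, 'v) tensor \<times> (H, 'v) tensor \<times> (H, 'v) tensor"

fun T_diff :: "'v::f2_space T4 \<Rightarrow> 'v T4" where
  "T_diff (y1, y3, y4, y6) =
     (Q1_T y1, Q1_T y3 + s_T (Q0_T y1), Q1_T y4 + s_T y1 + a_T (Q0_T y3), Q1_T y6 + s_T y3 + s_T (Q0_T y4) + a_T y4)"

lemma T_diff_add: "T_diff (x + y) = T_diff x + T_diff y"
  by (cases x; cases y) (simp add: T_add ac_simps)

lemma T_diff_diff: "T_diff (T_diff y) = 0"
  by (cases y) (simp add: T_add T_zero T_relations ac_simps add_self f2_add_left_self zero_prod_def)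

lemma T4_swap: "y + p = q \<Longrightarrow> y = p + (q :: 'v::f2_space T4)"
  by (cases y; cases p; cases q) (auto simp: add.assoc add_self ac_simps f2_add_left_self)

text \<open>
  Elimination in two rounds.  In the first, dividing by \<open>s\<close> makes the entries \<open>4\<close> and \<open>6\<close> elements of \<open>\<bbbF>[a] \<otimes> V\<close>.
  The cycle condition then forces entry \<open>4\<close> to vanish, since \<open>a\<close> is injective on \<open>\<bbbF>[a]\<close> and the image
  of \<open>s\<close> meets \<open>\<bbbF>[a]\<close> in \<open>0\<close>, and it puts entry \<open>3\<close> into the kernel of \<open>s\<close>.  In the second round, dividing by \<open>a\<close>
  removes entry \<open>3\<close> and all of entry \<open>6\<close> except its coefficient of \<open>1\<close>; the cycle condition leaves of
  entry \<open>1\<close> only a multiple of \<open>\<sigma>\<^sup>2\<close>.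
\<close>

lemma T_homology:
  fixes y :: "'v::f2_space T4"
  assumes "T_diff y = 0"
  shows "\<exists>x u w. y = T_diff x + (basis (Neg 0 0) \<otimes> u, 0, 0, basis (Pos 0 0) \<otimes> w)"
proof -
  obtain y1 y3 y4 y6 where y: "y = (y1, y3, y4, y6)" by (metis prod_cases4)
  (* chosen such that s x3 cancels entry 6, and then s x1 cancels entry 4, up to the cokernel of s *)
  define x3 where "x3 = div_s_T y6"
  define x1 where "x1 = div_s_T (y4 + a_T (Q0_T x3))"
  define z1 where "z1 = y1 + Q1_T x1"
  define z3 where "z3 = y3 + Q1_T x3 + s_T (Q0_T x1)"
  define z4 where "z4 = coker_T (y4 + a_T (Q0_T x3))"
  define z6 where "z6 = coker_T y6"
  have z: "y + T_diff (x1, x3, 0, 0) = (z1, z3, z4, z6)"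
    by (simp add: y z1_def z3_def z4_def z6_def coker_T_eq x1_def x3_def T_zero T_add ac_simps)
  have "T_diff (z1, z3, z4, z6) = 0"
    unfolding z[symmetric] by (simp only: T_diff_add T_diff_diff assms add_0_left)
  moreover have z46: "coker_T z4 = z4" "coker_T z6 = z6" "Q0_T z4 = 0" "Q1_T z4 = 0" "Q1_T z6 = 0"
    by (simp_all only: z4_def z6_def T_division)
  ultimately have eqs: "Q1_T z1 = 0" "Q1_T z3 + s_T (Q0_T z1) = 0" "s_T z1 + a_T (Q0_T z3) = 0"
    "s_T z3 + a_T z4 = 0"
    by (simp_all add: zero_prod_def T_zero)
  have "coker_T (s_T z3 + a_T z4) = a_T z4"
    using T_division(6)[of z4] z46(1) by (simp add: T_add T_division(1))
  then have "a_T z4 = 0" using eqs(4) by (simp add: T_zero)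
  then have z4: "z4 = 0" using T_division(7)[of z4] z46(1) by (simp add: T_zero)
  then have "s_T z3 = 0" using eqs(4) by (simp add: T_zero)
  then have z3: "ker_T z3 = z3" by (simp add: ker_T_eq T_zero)
  (* z3 = s Q0 (z3 / a), because z3 lies in the kernel of s; and a (z6 / a) is z6 without its constant term *)
  define v1 where "v1 = z1 + Q1_T (div_a_T z3)"
  have "Q1_T (div_a_T z6) = 0" "Q0_T (div_a_T z6) = 0"
    using T_division(3,4)[of "div_a_T z6"] T_division(8)[of z6] z46(2) by simp_all
  moreover have "a_T (div_a_T z6) = z6 + proj_T (Pos 0 0) z6"
    using T_division(9)[of z6] z46(2) by simp
  moreover have "s_T (div_a_T z3) = 0" "s_T (Q0_T (div_a_T z3)) = z3"
    using T_division(10,11)[of z3] z3 by simp_all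
  ultimately have v: "(z1, z3, z4, z6) + T_diff (div_a_T z3, 0, div_a_T z6, 0) = (v1, 0, 0, proj_T (Pos 0 0) z6)"
    by (simp add: v1_def z4 T_zero add_self f2_add_left_self)
  have "T_diff (v1, 0, 0, proj_T (Pos 0 0) z6) = 0"
    unfolding v[symmetric] by (simp only: T_diff_add T_diff_diff \<open>T_diff (z1, z3, z4, z6) = 0\<close> add_0_left)
  then have "s_T v1 = 0" "s_T (Q0_T v1) = 0" by (simp_all add: zero_prod_def T_zero)
  then have "ker_T v1 = v1" "v1 = proj_T (Neg 0 0) v1"
    using ker_T_eq[of v1] T_division(12)[of v1]
    by (simp_all add: T_zero) (metis add_eq_0_iff f2_uminus)
  then have "(v1, 0, 0, proj_T (Pos 0 0) z6) = (basis (Neg 0 0) \<otimes> T_coeff (Neg 0 0) v1, 0, 0, basis (Pos 0 0) \<otimes> T_coeff (Pos 0 0) z6)"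
    by (simp add: proj_T_eq)
  moreover have "y = T_diff ((x1, x3, 0, 0) + (div_a_T z3, 0, div_a_T z6, 0)) + (v1, 0, 0, proj_T (Pos 0 0) z6)"
    by (rule T4_swap) (simp only: T_diff_add add.assoc[symmetric] z v)
  ultimately show ?thesis by metis
qed

section \<open>The kernel of \<open>Q\<^sub>0\<close> on \<open>R F\<close>\<close>

lemma additive_act: "additive (\<lambda>x. w \<bullet> x)"
  by (simp add: additive_def act_add_right)

lemma H_sigma_mon: "H_sigma 0 = basis (Pos 0 0)" "H_sigma 2 = basis (Neg 0 0)"
  by (simp_all add: H_sigma_def pos_def neg_def)

lemma generators_induct [case_names zero gen add]:
  fixes t :: "('w::f2_space, gens) tensor"
  assumes "P 0" "\<And>v k. P (v \<otimes> basis k)" "\<And>s t. P s \<Longrightarrow> P t \<Longrightarrow> P (s + t)"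
  shows "P t"
proof (induction t rule: tensor_induct)
  case (pure v g)
  show ?case
    by (induction g rule: f2_poly_induct) (use assms in \<open>simp_all add: tensor_add_right\<close>)
qed (use assms in blast)+

text \<open>
  The first is a cycle because \<open>Q\<^sub>0\<close> and \<open>Q\<^sub>1\<close> vanish on \<open>1\<close> and the top class of \<open>\<A>(1)\<close> is killed by \<open>Sq\<^sup>1\<close>
  and \<open>Sq\<^sup>2\<close>; the second because \<open>a \<sigma>\<^sup>2 = \<sigma>\<^sup>-\<^sup>1 \<sigma>\<^sup>2 = 0\<close> and \<open>Sq\<^sup>1Sq\<^sup>1 = 0\<close>.
\<close>

lemma generator_cycles:
  "H_sigma 0 \<otimes> Sq2 \<bullet> Sq2 \<bullet> Sq2 \<bullet> x \<in> RM.cycles"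
  "H_sigma 2 \<otimes> Sq1 \<bullet> x \<in> RM.cycles"
proof -
  have h: "H_Q0 (basis (Pos 0 0)) = 0" "H_Q1 (basis (Pos 0 0)) = 0" "H_Q0 (basis (Neg 0 0)) = 0" "H_Q1 (basis (Neg 0 0)) = 0"
    "H_a \<cdot> basis (Neg 0 0) = 0" "H_sigma (-1) \<cdot> basis (Neg 0 0) = 0"
    by (simp_all add: H_mon_simps)
  show "H_sigma 0 \<otimes> Sq2 \<bullet> Sq2 \<bullet> Sq2 \<bullet> x \<in> RM.cycles" "H_sigma 2 \<otimes> Sq1 \<bullet> x \<in> RM.cycles"
    by (simp_all add: RM.cycles_def H_sigma_mon R_simps h)
qed

context A1_coordinates
begin

definition emb :: "A1 \<Rightarrow> (H, 'v) tensor \<Rightarrow> 'm R" where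
  "emb w = tensor_map (\<lambda>h. h) (\<lambda>v. w \<bullet> inc v)"

definition coord :: "A1 \<Rightarrow> 'm R \<Rightarrow> (H, 'v) tensor" where
  "coord w = tensor_map (\<lambda>h. h) (\<lambda>x. top_coord (w \<bullet> x))"

lemmas act_inc_add = additive_comp[OF additive_act additive_inc]
lemmas top_coord_act_add = additive_comp[OF additive_top_coord additive_act]

lemma emb_pure: "emb w (h \<otimes> v) = h \<otimes> w \<bullet> inc v"
  by (simp add: emb_def tensor_map_pure additive_id act_inc_add)

lemma additive_emb: "additive (emb w)"
  by (simp add: emb_def additive_tensor_map additive_id act_inc_add)

lemma coord_pure: "coord w (h \<otimes> x) = h \<otimes> top_coord (w \<bullet> x)"
  by (simp add: coord_def tensor_map_pure additive_id top_coord_act_add)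

lemma additive_coord: "additive (coord w)"
  by (simp add: coord_def additive_tensor_map additive_id top_coord_act_add)

lemmas R_coord_add = additive.add[OF additive_emb] additive.add[OF additive_coord] T_add R_add_simps
lemmas R_coord_zero = additive.zero[OF additive_emb] additive.zero[OF additive_coord] T_zero R_zero_simps
  additive.zero[OF additive_inc] additive.zero[OF additive_top_coord]

text \<open>
  \<open>from_ker_coords\<close> identifies the fourfold sum of \<open>T\<close> with the image of \<open>Q\<^sub>0\<close>, and hence with its
  kernel.  The inverse \<open>ker_coords\<close> reads the coordinates at \<open>Sq\<^sup>1, Sq\<^sup>1Sq\<^sup>2, Sq\<^sup>1Sq\<^sup>2Sq\<^sup>1, Sq\<^sup>1Sq\<^sup>2Sq\<^sup>1Sq\<^sup>2\<close>,
  that is, the top coordinates after acting by the words dual to these.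
\<close>

fun from_ker_coords :: "'v T4 \<Rightarrow> 'm R" where
  "from_ker_coords (y1, y3, y4, y6) = R_Q0 (emb 1 y1) + R_Q0 (emb Sq2 y3) + R_Q0 (emb (Sq2 * Sq1) y4) + R_Q0 (emb (Sq2 * Sq1 * Sq2) y6)"

lemma from_ker_coords_add: "from_ker_coords (x + y) = from_ker_coords x + from_ker_coords y"
  by (cases x; cases y) (simp add: R_coord_add ac_simps)

fun ker_coords :: "'m R \<Rightarrow> 'v T4" where
  "ker_coords z = (coord (Sq2 * Sq1 * Sq2) z, coord (Sq1 * Sq2) z, coord Sq2 z, coord 1 z)"

lemma R_Q0_from_ker_coords: "R_Q0 (from_ker_coords y) = 0"
  by (cases y) (simp add: R_add_simps RM.QQ0_QQ0)

lemma R_Q0_emb: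
  "R_Q0 (emb 1 t) = emb 1 (Q0_T t) + emb Sq1 t"
  "R_Q0 (emb Sq2 t) = emb Sq2 (Q0_T t) + emb (Sq1 * Sq2) t"
  "R_Q0 (emb (Sq2 * Sq1) t) = emb (Sq2 * Sq1) (Q0_T t) + emb (Sq1 * Sq2 * Sq1) t"
  "R_Q0 (emb (Sq2 * Sq1 * Sq2) t) = emb (Sq2 * Sq1 * Sq2) (Q0_T t) + emb (Sq1 * Sq2 * Sq1 * Sq2) t"
  by (induction t rule: tensor_induct;
      simp add: R_coord_add R_coord_zero emb_pure R_pure T_pure act_mult act_one Q0_def ac_simps)+

lemma coord_R_Q0: "coord w (R_Q0 z) = Q0_T (coord w z) + coord (w * Sq1) z"
  by (induction z rule: tensor_induct)
    (simp_all add: R_coord_add R_coord_zero coord_pure R_pure T_pure act_mult Q0_def ac_simps)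

lemma ker_coords_from_ker_coords: "ker_coords (from_ker_coords y) = y"
proof -
  have "coord (Sq2 * Sq1 * Sq2) (R_Q0 (emb 1 t)) = t" "coord (Sq2 * Sq1 * Sq2) (R_Q0 (emb Sq2 t)) = 0"
    "coord (Sq2 * Sq1 * Sq2) (R_Q0 (emb (Sq2 * Sq1) t)) = 0" "coord (Sq2 * Sq1 * Sq2) (R_Q0 (emb (Sq2 * Sq1 * Sq2) t)) = 0"
    "coord (Sq1 * Sq2) (R_Q0 (emb 1 t)) = 0" "coord (Sq1 * Sq2) (R_Q0 (emb Sq2 t)) = t"
    "coord (Sq1 * Sq2) (R_Q0 (emb (Sq2 * Sq1) t)) = 0" "coord (Sq1 * Sq2) (R_Q0 (emb (Sq2 * Sq1 * Sq2) t)) = 0"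
    "coord Sq2 (R_Q0 (emb 1 t)) = 0" "coord Sq2 (R_Q0 (emb Sq2 t)) = 0"
    "coord Sq2 (R_Q0 (emb (Sq2 * Sq1) t)) = t" "coord Sq2 (R_Q0 (emb (Sq2 * Sq1 * Sq2) t)) = 0"
    "coord 1 (R_Q0 (emb 1 t)) = 0" "coord 1 (R_Q0 (emb Sq2 t)) = 0"
    "coord 1 (R_Q0 (emb (Sq2 * Sq1) t)) = 0" "coord 1 (R_Q0 (emb (Sq2 * Sq1 * Sq2) t)) = t" for t
    by (induction t rule: tensor_induct;
      simp add: R_coord_add R_coord_zero emb_pure coord_pure R_pure act_mult act_one Q0_def A1_act_relations top_coord_inc)+
  then show ?thesis
    by (cases y) (simp add: R_coord_add)
qed

text \<open>
  \<open>Q\<^sub>1\<close> and \<open>Q\<^sub>0\<close> commute, and before applying \<open>Q\<^sub>0\<close> the element \<open>Q\<^sub>1(h \<otimes> w v)\<close> may be changed by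
  elements \<open>Q\<^sub>0(h' \<otimes> x) = Q\<^sub>0(h') \<otimes> x + h' \<otimes> Sq\<^sup>1 x\<close>; this removes all words beginning with \<open>Sq\<^sup>1\<close>.
\<close>

lemma R_Q1_R_Q0_emb:
  "R_Q1 (R_Q0 (emb 1 t)) = R_Q0 (emb 1 (Q1_T t)) + R_Q0 (emb Sq2 (s_T (Q0_T t))) + R_Q0 (emb (Sq2 * Sq1) (s_T t))"
  "R_Q1 (R_Q0 (emb Sq2 t)) = R_Q0 (emb Sq2 (Q1_T t)) + R_Q0 (emb (Sq2 * Sq1) (a_T (Q0_T t)))
     + R_Q0 (emb (Sq2 * Sq1 * Sq2) (s_T t))"
  "R_Q1 (R_Q0 (emb (Sq2 * Sq1) t)) = R_Q0 (emb (Sq2 * Sq1) (Q1_T t))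
     + R_Q0 (emb (Sq2 * Sq1 * Sq2) (s_T (Q0_T t))) + R_Q0 (emb (Sq2 * Sq1 * Sq2) (a_T t))"
  "R_Q1 (R_Q0 (emb (Sq2 * Sq1 * Sq2) t)) = R_Q0 (emb (Sq2 * Sq1 * Sq2) (Q1_T t))"
  by (induction t rule: tensor_induct;
      simp add: R_coord_add R_coord_zero emb_pure T_pure R_simps act_one ac_simps)+

lemma R_Q1_from_ker_coords: "R_Q1 (from_ker_coords y) = from_ker_coords (T_diff y)"
  by (cases y) (simp add: R_coord_add R_Q1_R_Q0_emb add.assoc add.commute add.left_commute)

lemma R_decompose:
  "z = emb 1 (coord (Sq1 * Sq2 * Sq1 * Sq2) z) + emb Sq1 (coord (Sq2 * Sq1 * Sq2) z)
    + emb Sq2 (coord (Sq1 * Sq2 * Sq1) z) + emb (Sq1 * Sq2) (coord (Sq1 * Sq2) z)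
    + emb (Sq2 * Sq1) (coord (Sq2 * Sq1) z) + emb (Sq1 * Sq2 * Sq1) (coord Sq2 z)
    + emb (Sq2 * Sq1 * Sq2) (coord Sq1 z) + emb (Sq1 * Sq2 * Sq1 * Sq2) (coord 1 z)"
proof (induction z rule: tensor_induct)
  case (pure h x)
  show ?case
    unfolding emb_pure coord_pure act_mult act_one tensor_add_right[symmetric]
    by (rule arg_cong[of x _ "\<lambda>x. h \<otimes> x"], rule decompose)
next
  case (add s t)
  show ?case
    by (subst add(1), subst add(2)) (simp add: R_coord_add ac_simps)
qed (simp add: R_coord_zero)

text \<open>
  If \<open>Q\<^sub>0 z = 0\<close>, then the coordinate of \<open>z\<close> at a word \<open>w\<close> not beginning with \<open>Sq\<^sup>1\<close> is \<open>Q\<^sub>0\<close> of its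
  coordinate at \<open>Sq\<^sup>1 w\<close>, by \<open>coord_R_Q0\<close>: so \<open>z\<close> is determined by the four coordinates.
\<close>

lemma from_ker_coords_ker_coords:
  assumes "R_Q0 z = 0"
  shows "from_ker_coords (ker_coords z) = z"
proof -
  have c: "coord (w * Sq1) z = Q0_T (coord w z)" for w
  proof -
    have "Q0_T (coord w z) + coord (w * Sq1) z = 0"
      using coord_R_Q0[of w z] assms by (simp add: R_coord_zero)
    then show ?thesis by (metis f2_uminus add_eq_0_iff)
  qed
  have w: "Sq2 * Sq1 * Sq2 * Sq1 = Sq1 * Sq2 * Sq1 * Sq2"
  proof -
    have "Sq2 * Sq1 * Sq2 * Sq1 = Sq2 * (Sq1 * Sq2 * Sq1)" by (simp only: mult.assoc)
    also have "\<dots> = Sq2 * (Sq2 * Sq2)" by (simp only: Sq2_Sq2)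
    also have "\<dots> = (Sq2 * Sq2) * Sq2" by (simp only: mult.assoc)
    also have "\<dots> = Sq1 * Sq2 * Sq1 * Sq2" by (simp only: Sq2_Sq2)
    finally show ?thesis .
  qed
  have "from_ker_coords (ker_coords z) = emb 1 (coord (Sq1 * Sq2 * Sq1 * Sq2) z) + emb Sq1 (coord (Sq2 * Sq1 * Sq2) z)
    + emb Sq2 (coord (Sq1 * Sq2 * Sq1) z) + emb (Sq1 * Sq2) (coord (Sq1 * Sq2) z)
    + emb (Sq2 * Sq1) (coord (Sq2 * Sq1) z) + emb (Sq1 * Sq2 * Sq1) (coord Sq2 z)
    + emb (Sq2 * Sq1 * Sq2) (coord Sq1 z) + emb (Sq1 * Sq2 * Sq1 * Sq2) (coord 1 z)"
    using c[of "Sq2 * Sq1 * Sq2"] c[of "Sq1 * Sq2"] c[of Sq2] c[of 1]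
    by (simp add: R_Q0_emb w add.assoc add.commute add.left_commute)
  also have "\<dots> = z" by (rule R_decompose[symmetric])
  finally show ?thesis .
qed

section \<open>Cycles representing the classes, and their coefficients\<close>

text \<open>
  The coefficient of \<open>1\<close> in the coordinate at \<open>Sq\<^sup>2Sq\<^sup>2Sq\<^sup>2\<close> and the coefficient of \<open>\<sigma>\<^sup>2\<close> in the coordinate
  at \<open>Sq\<^sup>1\<close>.  It is a left inverse of \<open>gens_cycle\<close> and vanishes on boundaries, so it induces the
  inverse of the isomorphism.
\<close>

definition gens_coeff :: "'m R \<Rightarrow> ('v, gens) tensor" where
  "gens_coeff z = T_coeff (Pos 0 0) (coord 1 z) \<otimes> basis Sq2Sq2Sq2
     + T_coeff (Neg 0 0) (coord (Sq2 * Sq1 * Sq2) z) \<otimes> basis sigma2Sq1"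

definition gens_cycle :: "('v, gens) tensor \<Rightarrow> 'm R" where
  "gens_cycle = tensor_lift (\<lambda>v g. f2_scale (Poly_Mapping.lookup g Sq2Sq2Sq2) (H_sigma 0 \<otimes> Sq2 \<bullet> Sq2 \<bullet> Sq2 \<bullet> inc v)
     + f2_scale (Poly_Mapping.lookup g sigma2Sq1) (H_sigma 2 \<otimes> Sq1 \<bullet> inc v))"

lemma additive_gens_coeff: "additive gens_coeff"
  by (simp add: additive_def gens_coeff_def R_coord_add additive.add[OF additive_T_coeff] tensor_add_left ac_simps)

lemma biadditive_gens_cycle: "biadditive (\<lambda>v (g::gens). f2_scale (Poly_Mapping.lookup g Sq2Sq2Sq2) (H_sigma 0 \<otimes> Sq2 \<bullet> Sq2 \<bullet> Sq2 \<bullet> inc v)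
     + f2_scale (Poly_Mapping.lookup g sigma2Sq1) (H_sigma 2 \<otimes> Sq1 \<bullet> inc v))"
  unfolding biadditive_def additive_def lookup_add F2.scale_left_distrib additive.add[OF additive_inc]
    act_add_right tensor_add_right F2.scale_right_distrib by (simp only: ac_simps simp_thms)

lemma additive_gens_cycle: "additive gens_cycle"
  unfolding gens_cycle_def by (rule additive_tensor_lift, rule biadditive_gens_cycle)

lemma gens_cycle_pure: "gens_cycle (v \<otimes> basis Sq2Sq2Sq2) = H_sigma 0 \<otimes> Sq2 \<bullet> Sq2 \<bullet> Sq2 \<bullet> inc v"
  "gens_cycle (v \<otimes> basis sigma2Sq1) = H_sigma 2 \<otimes> Sq1 \<bullet> inc v"
  unfolding gens_cycle_def tensor_lift_pure[OF biadditive_gens_cycle] by (simp_all add: lookup_single f2_scale_def)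

lemma gens_cycle_in_cycles: "gens_cycle t \<in> RM.cycles"
proof (induction t rule: generators_induct)
  case (gen v k)
  then show ?case by (cases k) (simp_all only: gens_cycle_pure generator_cycles)
qed (simp_all add: additive.zero[OF additive_gens_cycle] additive.add[OF additive_gens_cycle] RM.cycles_def R_zero_simps R_add_simps)

lemma top_coord_Sq2: "top_coord (Sq2 \<bullet> Sq2 \<bullet> Sq2 \<bullet> inc v) = v"
  by (simp add: A1_act_relations top_coord_inc)

lemma gens_coeff_generators:
  "gens_coeff (H_sigma 0 \<otimes> Sq2 \<bullet> Sq2 \<bullet> Sq2 \<bullet> x) = top_coord (Sq2 \<bullet> Sq2 \<bullet> Sq2 \<bullet> x) \<otimes> basis Sq2Sq2Sq2"
  "gens_coeff (H_sigma 2 \<otimes> Sq1 \<bullet> x) = top_coord (Sq2 \<bullet> Sq2 \<bullet> Sq2 \<bullet> x) \<otimes> basis sigma2Sq1"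
  by (simp_all add: gens_coeff_def coord_pure T_coeff_pure H_sigma_mon lookup_single f2_scale_def act_mult act_one A1_act_relations)

lemma gens_coeff_gens_cycle: "gens_coeff (gens_cycle t) = t"
proof (induction t rule: generators_induct)
  case (gen v k)
  then show ?case by (cases k) (simp_all only: gens_cycle_pure gens_coeff_generators top_coord_Sq2)
qed (simp_all add: additive.zero[OF additive_gens_cycle] additive.add[OF additive_gens_cycle] additive.zero[OF additive_gens_coeff] additive.add[OF additive_gens_coeff])

text \<open>
  A boundary corresponds to some \<open>T_diff y\<close>.  In its last entry every term is a multiple of \<open>a\<close> or \<open>s\<close> or
  lies in the image of \<open>Q\<^sub>1\<close>, and none of these contains \<open>1\<close>; its first entry is \<open>Q\<^sub>1 y\<^sub>1\<close>, which does not
  involve \<open>\<sigma>\<^sup>2\<close>.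
\<close>

lemma gens_coeff_boundary:
  assumes "z \<in> RM.boundaries"
  shows "gens_coeff z = 0"
proof -
  obtain x where x: "z = R_Q1 x" "R_Q0 x = 0" using assms by (auto simp: RM.boundaries_def)
  obtain y1 y3 y4 y6 where y: "ker_coords x = (y1, y3, y4, y6)" by (metis prod_cases4)
  have "z = from_ker_coords (T_diff (ker_coords x))"
    by (simp only: x(1) R_Q1_from_ker_coords[symmetric] from_ker_coords_ker_coords[OF x(2)])
  then have "ker_coords z = T_diff (y1, y3, y4, y6)" by (simp only: ker_coords_from_ker_coords y)
  then have "coord (Sq2 * Sq1 * Sq2) z = Q1_T y1" "coord 1 z = Q1_T y6 + s_T y3 + s_T (Q0_T y4) + a_T y4"
    by simp_all
  moreover have "T_coeff (Neg 0 0) (Q1_T t) = 0" "T_coeff (Pos 0 0) (Q1_T t) = 0" "T_coeff (Pos 0 0) (s_T t) = 0"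
    "T_coeff (Pos 0 0) (a_T t) = 0" for t :: "(H, 'v) tensor"
    by (rule T_coeff_zero; simp add: additive_H H_division)+
  ultimately show ?thesis by (simp add: gens_coeff_def additive.add[OF additive_T_coeff])
qed

lemma cycle_gens_boundary:
  assumes "z \<in> RM.cycles"
  shows "z + gens_cycle (gens_coeff z) \<in> RM.boundaries"
proof -
  have z: "R_Q0 z = 0" "R_Q1 z = 0" using assms by (auto simp: RM.cycles_def)
  have "from_ker_coords (T_diff (ker_coords z)) = from_ker_coords 0"
    by (simp only: R_Q1_from_ker_coords[symmetric] from_ker_coords_ker_coords[OF z(1)] z(2)) (simp add: zero_prod_def R_coord_zero)
  then have "T_diff (ker_coords z) = 0" using ker_coords_from_ker_coords by metis
  then obtain x u w where "ker_coords z = T_diff x + (basis (Neg 0 0) \<otimes> u, 0, 0, basis (Pos 0 0) \<otimes> w)"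
    using T_homology by blast
  then have "z = from_ker_coords (T_diff x) + from_ker_coords (basis (Neg 0 0) \<otimes> u, 0, 0, basis (Pos 0 0) \<otimes> w)"
    using from_ker_coords_ker_coords[OF z(1)] by (metis from_ker_coords_add)
  also have "from_ker_coords (T_diff x) = R_Q1 (from_ker_coords x)" by (rule R_Q1_from_ker_coords[symmetric])
  also have "from_ker_coords (basis (Neg 0 0) \<otimes> u, 0, 0, basis (Pos 0 0) \<otimes> w) =
      gens_cycle (w \<otimes> basis Sq2Sq2Sq2 + u \<otimes> basis sigma2Sq1)"
    by (simp add: additive.add[OF additive_gens_cycle] gens_cycle_pure R_coord_zero R_pure Q0_def H_Q_mon emb_pure
        H_sigma_mon act_mult act_one A1_act_relations add.commute)
  finally have eq: "z = R_Q1 (from_ker_coords x) + gens_cycle (w \<otimes> basis Sq2Sq2Sq2 + u \<otimes> basis sigma2Sq1)" .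
  have b: "R_Q1 (from_ker_coords x) \<in> RM.boundaries" by (auto simp: RM.boundaries_def R_Q0_from_ker_coords)
  have "gens_coeff z = w \<otimes> basis Sq2Sq2Sq2 + u \<otimes> basis sigma2Sq1"
    unfolding eq by (simp only: additive.add[OF additive_gens_coeff] gens_coeff_boundary[OF b] gens_coeff_gens_cycle add_0_left)
  with eq have "z + gens_cycle (gens_coeff z) = R_Q1 (from_ker_coords x)" by (metis add.assoc add_self add.right_neutral)
  with b show ?thesis by simp
qed

end

section \<open>The action of \<open>\<bbbF>[a, \<sigma>\<^sup>-\<^sup>4]\<close>\<close>

lemma R_scale_commutes:
  assumes "\<And>h. g \<cdot> H_Q0 h = H_Q0 (g \<cdot> h)" "\<And>h. g \<cdot> H_Q1 h = H_Q1 (g \<cdot> h)"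
    "\<And>h. g \<cdot> (H_a \<cdot> h) = H_a \<cdot> (g \<cdot> h)" "\<And>h. g \<cdot> (H_sigma (-1) \<cdot> h) = H_sigma (-1) \<cdot> (g \<cdot> h)"
  shows "R_scale g (R_Q0 z) = R_Q0 (R_scale g z)" "R_scale g (R_Q1 z) = R_Q1 (R_scale g z)"
  by (induction z rule: tensor_induct;
      simp add: R_zero_simps R_add_simps additive.zero[OF additive_R(3)] additive.add[OF additive_R(3)] R_pure assms)+

text \<open>
  \<open>\<sigma>\<^sup>-\<^sup>4\<close> commutes with \<open>Q\<^sub>0\<close> and \<open>Q\<^sub>1\<close> although \<open>\<sigma>\<^sup>-\<^sup>1\<close> does not: in its fourth power, each term of the
  commutators occurs an even number of times.
\<close>

lemma H_sigma4_eq: "H_sigma (-4) \<cdot> h = H_sigma (-1) \<cdot> (H_sigma (-1) \<cdot> (H_sigma (-1) \<cdot> (H_sigma (-1) \<cdot> h)))"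
proof (induction h rule: f2_poly_induct)
  case (basis k)
  have 4: "H_sigma (-4) = basis (Pos 0 4)" by (simp add: H_sigma_def pos_def)
  show ?case
  proof (cases k)
    case (Pos m n)
    have "nat (int n + 4) = Suc (Suc (Suc (Suc n)))" by simp
    then show ?thesis by (simp add: 4 Pos H_s_mon) (simp add: H_mult_def pos_def)
  next
    case (Neg m n)
    have "n = 0 \<or> n = 1 \<or> n = 2 \<or> n = 3 \<or> (\<exists>l. n = Suc (Suc (Suc (Suc l))))" by presburger
    then consider "n = 0" | "n = Suc 0" | "n = Suc (Suc 0)" | "n = Suc (Suc (Suc 0))" | l where "n = Suc (Suc (Suc (Suc l)))"
      by fastforce
    then show ?thesis
      by cases ((simp add: 4 Neg H_s_mon H_zero_simps)?, simp add: H_mult_def neg_def)+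
  qed
qed (simp_all only: H_add_simps H_zero_simps)

lemma H_sigma4:
  "H_sigma (-4) \<cdot> H_Q0 h = H_Q0 (H_sigma (-4) \<cdot> h)"
  "H_sigma (-4) \<cdot> H_Q1 h = H_Q1 (H_sigma (-4) \<cdot> h)"
  "H_sigma (-4) \<cdot> (H_a \<cdot> h) = H_a \<cdot> (H_sigma (-4) \<cdot> h)"
  "H_sigma (-4) \<cdot> (H_sigma (-1) \<cdot> h) = H_sigma (-1) \<cdot> (H_sigma (-4) \<cdot> h)"
  by (simp_all add: H_sigma4_eq H_relations H_add_simps H_zero_simps add_self f2_add_left_self ac_simps)

section \<open>The isomorphism and the grading\<close>

lemma gr_lookup: "p \<in> gr d \<Longrightarrow> Poly_Mapping.lookup p k \<noteq> 0 \<Longrightarrow> d = deg k"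
  unfolding gr_poly_mapping_def by (auto simp only: in_keys_iff mem_Collect_eq)

context A1_coordinates
begin

lemma hclass_gens_cycle_coeff: "z \<in> RM.cycles \<Longrightarrow> RM.hclass (gens_cycle (gens_coeff z)) = RM.hclass z"
  by (metis RM.hclass_eq_iff cycle_gens_boundary add.commute)

lemma bij_betw_H01: "bij_betw (\<lambda>t. RM.hclass (gens_cycle t)) UNIV RM.H01"
  unfolding bij_betw_def
proof
  show "inj (\<lambda>t. RM.hclass (gens_cycle t))"
  proof (rule injI)
    fix s t assume "RM.hclass (gens_cycle s) = RM.hclass (gens_cycle t)"
    then have "gens_cycle (s + t) \<in> RM.boundaries"
      by (simp add: RM.hclass_eq_iff additive.add[OF additive_gens_cycle])
    then have "s + t = 0" using gens_coeff_boundary gens_coeff_gens_cycle by metis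
    then show "s = t" by (metis f2_uminus add_eq_0_iff)
  qed
  show "range (\<lambda>t. RM.hclass (gens_cycle t)) = RM.H01"
    unfolding RM.H01_def using gens_cycle_in_cycles hclass_gens_cycle_coeff by (auto simp: image_iff)
qed

lemma gens_cycle_gr:
  assumes "t \<in> gr d"
  shows "gens_cycle t \<in> gr d"
  using assms unfolding gr_tensor_def[of d]
proof (induction t rule: F2.span_induct_alt)
  case base
  show ?case by (simp add: additive.zero[OF additive_gens_cycle] F2.span_zero)
next
  case (step c s t)
  then obtain v y i j where s: "s = v \<otimes> y" "v \<in> gr i" "y \<in> gr j" "i + j = d" by blast
  have Sq2: "Sq2 \<bullet> x \<in> gr (e + (2, 0))" if "x \<in> gr e" for x :: 'm and e
    by (rule act_Q_gr[OF that])
  have "H_sigma 0 \<otimes> Sq2 \<bullet> Sq2 \<bullet> Sq2 \<bullet> inc v \<in> gr d" if "Poly_Mapping.lookup y Sq2Sq2Sq2 \<noteq> 0"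
  proof (rule pure_gr)
    show "H_sigma 0 \<in> gr (0, 0)" by (simp add: H_sigma_mon gr_poly_mapping_def)
    show "Sq2 \<bullet> Sq2 \<bullet> Sq2 \<bullet> inc v \<in> gr (i + (2, 0) + (2, 0) + (2, 0))" by (intro Sq2 inc_gr s)
    have "j = (6, 0)" using gr_lookup[OF s(3) that] by simp
    then show "(0, 0) + (i + (2, 0) + (2, 0) + (2, 0)) = d" using s(4) by (cases i) auto
  qed
  moreover have "H_sigma 2 \<otimes> Sq1 \<bullet> inc v \<in> gr d" if "Poly_Mapping.lookup y sigma2Sq1 \<noteq> 0"
  proof (rule pure_gr)
    show "H_sigma 2 \<in> gr (2, -2)" by (simp add: H_sigma_mon gr_poly_mapping_def)
    show "Sq1 \<bullet> inc v \<in> gr (i + (1, 0))" using act_Q_gr(1)[OF inc_gr[OF s(2)]] by (simp add: Q0_def)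
    have "j = (3, -2)" using gr_lookup[OF s(3) that] by simp
    then show "(2, -2) + (i + (1, 0)) = d" using s(4) by (cases i) auto
  qed
  ultimately have "gens_cycle s \<in> gr d"
    unfolding s(1) gens_cycle_def tensor_lift_pure[OF biadditive_gens_cycle]
    by (intro tensor_gr_add) (auto simp: f2_scale_def gr_tensor_def F2.span_zero)
  then show ?case
    using step by (simp add: additive.add[OF additive_gens_cycle] additive_scale[OF additive_gens_cycle]
        F2.span_add F2.span_scale gr_tensor_def)
qed

lemma gens_coeff_gr:
  assumes "z \<in> gr d"
  shows "gens_coeff z \<in> gr d"
  using assms unfolding gr_tensor_def[of d]
proof (induction z rule: F2.span_induct_alt)
  case base
  show ?case by (simp add: additive.zero[OF additive_gens_coeff] F2.span_zero)
next
  case (step c s t)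
  then obtain h x i j where s: "s = h \<otimes> x" "h \<in> gr i" "x \<in> gr j" "i + j = d" by blast
  have Sq: "Sq1 \<bullet> y \<in> gr (e + (1, 0))" "Sq2 \<bullet> y \<in> gr (e + (2, 0))" if "y \<in> gr e" for y :: 'm and e
    using act_Q_gr[OF that] by (simp_all add: Q0_def)
  have "top_coord x \<otimes> basis Sq2Sq2Sq2 \<in> gr d" if "Poly_Mapping.lookup h (Pos 0 0) \<noteq> 0"
  proof (rule pure_gr)
    show "top_coord x \<in> gr (j - (6, 0))" by (intro top_coord_gr s)
    show "basis Sq2Sq2Sq2 \<in> gr (6, 0)" by (simp add: gr_poly_mapping_def)
    have "i = (0, 0)" using gr_lookup[OF s(2) that] by simp
    then show "j - (6, 0) + (6, 0) = d" using s(4) by (cases j) auto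
  qed
  moreover have "top_coord (Sq2 \<bullet> Sq1 \<bullet> Sq2 \<bullet> x) \<otimes> basis sigma2Sq1 \<in> gr d" if "Poly_Mapping.lookup h (Neg 0 0) \<noteq> 0"
  proof (rule pure_gr)
    show "top_coord (Sq2 \<bullet> Sq1 \<bullet> Sq2 \<bullet> x) \<in> gr (j + (2, 0) + (1, 0) + (2, 0) - (6, 0))" by (intro top_coord_gr Sq s)
    show "basis sigma2Sq1 \<in> gr (3, -2)" by (simp add: gr_poly_mapping_def)
    have "i = (2, -2)" using gr_lookup[OF s(2) that] by simp
    then show "j + (2, 0) + (1, 0) + (2, 0) - (6, 0) + (3, -2) = d" using s(4) by (cases j) auto
  qed
  ultimately have "gens_coeff s \<in> gr d"
    unfolding s(1) gens_coeff_def coord_pure T_coeff_pure act_mult act_one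
    by (intro tensor_gr_add) (auto simp: f2_scale_def gr_tensor_def F2.span_zero)
  then show ?case
    using step by (simp add: additive.add[OF additive_gens_coeff] additive_scale[OF additive_gens_coeff]
        F2.span_add F2.span_scale gr_tensor_def)
qed

lemma image_gr_H01: "(\<lambda>t. RM.hclass (gens_cycle t)) ` gr d = RM.H01_gr d"
proof
  show "(\<lambda>t. RM.hclass (gens_cycle t)) ` gr d \<subseteq> RM.H01_gr d"
    unfolding RM.H01_gr_def using gens_cycle_gr gens_cycle_in_cycles by blast
  show "RM.H01_gr d \<subseteq> (\<lambda>t. RM.hclass (gens_cycle t)) ` gr d"
  proof
    fix C :: "'m R set" assume "C \<in> RM.H01_gr d"
    then obtain z where "z \<in> RM.cycles" "z \<in> gr d" "C = RM.hclass z" by (auto simp: RM.H01_gr_def)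
    then show "C \<in> (\<lambda>t. RM.hclass (gens_cycle t)) ` gr d"
      using gens_coeff_gr by (intro image_eqI[where x = "gens_coeff z"]) (simp_all add: hclass_gens_cycle_coeff)
  qed
qed

text \<open>
  A monomial of the positive cone other than \<open>1\<close> kills \<open>\<sigma>\<^sup>2\<close> and moves \<open>1\<close> to another monomial of the
  positive cone.  So it takes the representing cycles to cycles with both coefficients \<open>0\<close>.
\<close>

lemma H01_map_R_scale_zero:
  assumes comm: "\<And>h. g \<cdot> H_Q0 h = H_Q0 (g \<cdot> h)" "\<And>h. g \<cdot> H_Q1 h = H_Q1 (g \<cdot> h)"
    "\<And>h. g \<cdot> (H_a \<cdot> h) = H_a \<cdot> (g \<cdot> h)" "\<And>h. g \<cdot> (H_sigma (-1) \<cdot> h) = H_sigma (-1) \<cdot> (g \<cdot> h)"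
    and g: "g = basis (Pos i j)" "(i, j) \<noteq> (0, 0)"
    and C: "C \<in> (RM.H01 :: 'm R set set)"
  shows "RM.H01_map (R_scale g) C = RM.hclass 0"
proof -
  obtain t where t: "C = RM.hclass (gens_cycle t)" using C bij_betw_H01 by (auto simp: bij_betw_def)
  have "R_scale g (gens_cycle t) \<in> RM.cycles"
    using gens_cycle_in_cycles[of t] R_scale_commutes[of g "gens_cycle t"] comm
    by (simp add: RM.cycles_def additive.zero[OF additive_R(3)] flip: R_scale_commutes)
  moreover have "gens_coeff (R_scale g (gens_cycle t)) = 0"
  proof (induction t rule: generators_induct)
    case (gen v k)
    have "g \<cdot> H_sigma 0 = g" "g \<cdot> H_sigma 2 = 0" using g by (auto simp: H_sigma_mon H_mon_simps)
    moreover have "Poly_Mapping.lookup g (Pos 0 0) = 0" "Poly_Mapping.lookup g (Neg 0 0) = 0"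
      using g by (auto simp: lookup_single when_def)
    ultimately show ?case
      by (cases k) (simp_all add: gens_cycle_pure R_pure gens_coeff_def coord_pure T_coeff_pure R_coord_zero
          additive.zero[OF additive_T_coeff] f2_scale_def)
  qed (simp_all add: additive.zero[OF additive_gens_cycle] additive.add[OF additive_gens_cycle]
      additive.zero[OF additive_gens_coeff] additive.add[OF additive_gens_coeff]
      additive.zero[OF additive_R(3)] additive.add[OF additive_R(3)])
  ultimately have "R_scale g (gens_cycle t) \<in> RM.boundaries"
    using cycle_gens_boundary by (metis additive.zero[OF additive_gens_cycle] add.right_neutral)
  then have "RM.hclass (R_scale g (gens_cycle t)) = RM.hclass 0" by (simp add: RM.hclass_eq_iff)
  then show ?thesis
    by (simp add: t RM.H01_map_hclass additive_R R_scale_commutes comm)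
qed

end

section \<open>Degrees of the generators, and the computation of \<open>H\<^sub>0\<^sub>1\<close>\<close>

text \<open>
  \<open>V\<close> inherits from \<open>F\<close> a grading by integers, and the two generators have the degrees \<open>6\<close> and \<open>3 - 2\<alpha>\<close>.
\<close>

lemma free_homogeneous_sum:
  fixes t :: "('m::a1_module tensor_A1_F, gens) tensor"
  defines "D \<equiv> {(n, 0) | n. True} \<union> {(n, -2) | n. True}"
  shows "\<exists>T z. finite T \<and> T \<subseteq> D \<and> (\<forall>d\<in>T. z d \<in> gr d) \<and> t = (\<Sum>d\<in>T. z d)" (is "?P t")
proof -
  have sum_closed: "?P (s + t)" if st: "?P s" "?P t" for s t
  proof -
    obtain S y where S: "finite S" "S \<subseteq> D" "\<forall>d\<in>S. y d \<in> gr d" "s = (\<Sum>d\<in>S. y d)" using st(1) by blast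
    obtain T z where T: "finite T" "T \<subseteq> D" "\<forall>d\<in>T. z d \<in> gr d" "t = (\<Sum>d\<in>T. z d)" using st(2) by blast
    let ?w = "\<lambda>d. (if d \<in> S then y d else 0) + (if d \<in> T then z d else 0)"
    have "(\<Sum>d\<in>S \<union> T. if d \<in> S then y d else 0) = s" "(\<Sum>d\<in>S \<union> T. if d \<in> T then z d else 0) = t"
      unfolding S(4) T(4) by (rule sum.mono_neutral_cong_right; use S(1) T(1) in auto)+
    then have "s + t = (\<Sum>d\<in>S \<union> T. ?w d)" by (simp only: sum.distrib)
    moreover have "?w d \<in> gr d" for d
      using S(3) T(3) by (intro tensor_gr_add) (auto simp: gr_tensor_def F2.span_zero)
    ultimately show ?thesis
      using S(1,2) T(1,2) by (intro exI[of _ "S \<union> T"] exI[of _ ?w]) blast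
  qed
  have zero: "?P 0" by (intro exI[of _ "{}"]) simp
  have homogeneous: "?P t" if "t \<in> gr d" "d \<in> D" for t d
    using that by (intro exI[of _ "{d}"] exI[of _ "\<lambda>_. t"]) simp
  show ?thesis
  proof (induction t rule: generators_induct)
    case (gen v k)
    obtain x where x: "v = x \<otimes>\<^sub>A 1" using tensor_A1_F_surj by blast
    have P: "?P ((degree_part e x \<otimes>\<^sub>A 1) \<otimes> basis k)" for e
    proof (cases "snd e = 0")
      case True
      have "(degree_part e x \<otimes>\<^sub>A 1) \<otimes> basis k \<in> gr (e + deg k)"
        by (rule pure_gr[OF pure_A1_gr[OF degree_part_gr]]) (simp_all add: gr_poly_mapping_def)
      moreover have "e + deg k \<in> D" using True by (cases e; cases k) (auto simp: D_def)
      ultimately show ?thesis by (rule homogeneous)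
    next
      case False
      then have "degree_part e x = 0" using degree_part_gr[of e x] gr_integral[of "snd e" "fst e", where 'a = 'm] by simp
      then show ?thesis using zero by (simp add: additive.zero[OF additive_pure_A1])
    qed
    obtain S where S: "finite S" "x = (\<Sum>e\<in>S. degree_part e x)" by (rule degree_part_sum[of x])
    have "?P (((\<Sum>e\<in>S. degree_part e x) \<otimes>\<^sub>A 1) \<otimes> basis k)"
      using S(1)
    proof (induction S)
      case empty
      show ?case using zero by (simp add: additive.zero[OF additive_pure_A1])
    next
      case (insert e S)
      then show ?case
        using sum_closed[OF P[of e]] by (simp add: additive.add[OF additive_pure_A1] tensor_add_left)
    qed
    then show ?case unfolding x S(2)[symmetric] .
  next
    case zero
    show ?case by (rule \<open>?P 0\<close>)
  next
    case (add s t)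
    then show ?case by (rule sum_closed)
  qed
qed

lemma free_gr_outside:
  fixes t :: "('m::a1_module tensor_A1_F, gens) tensor"
  assumes "t \<in> gr d" "d \<notin> {(n, 0) | n. True} \<union> {(n, -2) | n. True}"
  shows "t = 0"
  using assms(1) unfolding gr_tensor_def
proof (induction t rule: F2.span_induct_alt)
  case (step c s t)
  then obtain v y i j where s: "s = v \<otimes> y" "v \<in> gr i" "y \<in> gr j" "i + j = d" by blast
  have "s = 0"
  proof (cases "snd i = 0")
    case False
    obtain x where "x \<in> gr i" "v = x \<otimes>\<^sub>A 1" using s(2) by (rule tensor_A1_F_gr)
    then have "v = 0" using False gr_integral[of "snd i" "fst i", where 'a = 'm] by (simp add: additive.zero[OF additive_pure_A1])
    then show ?thesis by (simp add: s(1))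
  next
    case True
    have "k \<notin> Poly_Mapping.keys y" for k
    proof
      assume "k \<in> Poly_Mapping.keys y"
      then have "deg k = j" using s(3) by (simp add: gr_poly_mapping_def)
      then show False using True s(4) assms(2) by (cases k; cases i) auto
    qed
    then have "y = 0" by (metis all_not_in_conv keys_eq_empty)
    then show ?thesis by (simp add: s(1))
  qed
  with step show ?case by (simp add: F2.scale_zero_right)
qed simp

theorem corollary5p9:
  assumes "free_a1_module TYPE('f::a1_module)"
  shows "(\<exists>\<Phi> :: ('f tensor_A1_F, gens) tensor \<Rightarrow> 'f R set.
            bij_betw \<Phi> UNIV RM.H01
          \<and> (\<forall>s t. \<Phi> (s + t) = \<Phi> s + \<Phi> t)
          \<and> (\<forall>d. \<Phi> ` gr d = RM.H01_gr d)
          \<and> (\<forall>x. \<Phi> ((x \<otimes>\<^sub>A 1) \<otimes> basis Sq2Sq2Sq2) = RM.hclass (H_sigma 0 \<otimes> Sq2 \<bullet> Sq2 \<bullet> Sq2 \<bullet> x))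
          \<and> (\<forall>x. \<Phi> ((x \<otimes>\<^sub>A 1) \<otimes> basis sigma2Sq1) = RM.hclass (H_sigma 2 \<otimes> Sq1 \<bullet> x)))
       \<and> (\<forall>C \<in> (RM.H01 :: 'f R set set).
            RM.H01_map (R_scale H_a) C = RM.hclass 0
          \<and> RM.H01_map (R_scale (H_sigma (-4))) C = RM.hclass 0)
       \<and> RM.H01_concentrated_in TYPE('f) ({(n, 0) | n. True} \<union> {(n, -2) | n. True})"
proof -
  obtain B :: "'f set" where "free_basis B"
    using assms unfolding free_a1_module_def free_basis_def by blast
  then obtain inc :: "'f tensor_A1_F \<Rightarrow> 'f" and top_coord where coordinates: "A1_coordinates inc top_coord" and inc: "\<forall>v. inc v \<otimes>\<^sub>A 1 = v"
    by (rule free_coordinates)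
  interpret A1_coordinates inc top_coord by (rule coordinates)
  define \<Phi> where "\<Phi> t = RM.hclass (gens_cycle t)" for t
  have top_coord: "top_coord (Sq2 \<bullet> Sq2 \<bullet> Sq2 \<bullet> x) = x \<otimes>\<^sub>A 1" for x
  proof -
    have "x \<otimes>\<^sub>A 1 = inc (top_coord (Sq1 \<bullet> Sq2 \<bullet> Sq1 \<bullet> Sq2 \<bullet> x)) \<otimes>\<^sub>A 1"
      by (subst decompose[of x])
        (simp add: additive.add[OF additive_pure_A1] pure_A1_balanced A1_aug_simps f2_scale_def)
    then show ?thesis by (simp add: inc A1_act_relations)
  qed
  have gens: "\<Phi> ((x \<otimes>\<^sub>A 1) \<otimes> basis Sq2Sq2Sq2) = RM.hclass (H_sigma 0 \<otimes> Sq2 \<bullet> Sq2 \<bullet> Sq2 \<bullet> x)"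
    "\<Phi> ((x \<otimes>\<^sub>A 1) \<otimes> basis sigma2Sq1) = RM.hclass (H_sigma 2 \<otimes> Sq1 \<bullet> x)" for x
    using hclass_gens_cycle_coeff[OF generator_cycles(1), of x] hclass_gens_cycle_coeff[OF generator_cycles(2), of x]
    unfolding \<Phi>_def gens_coeff_generators top_coord by metis+
  have add: "\<Phi> (s + t) = \<Phi> s + \<Phi> t" for s t
    by (simp add: \<Phi>_def additive.add[OF additive_gens_cycle] RM.hclass_add)
  have bij: "bij_betw \<Phi> UNIV RM.H01" and gr: "\<And>d. \<Phi> ` gr d = RM.H01_gr d"
    unfolding \<Phi>_def by (rule bij_betw_H01 image_gr_H01)+
  have scale: "RM.H01_map (R_scale H_a) C = RM.hclass 0" "RM.H01_map (R_scale (H_sigma (-4))) C = RM.hclass 0"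
    if "C \<in> (RM.H01 :: 'f R set set)" for C
  proof -
    show "RM.H01_map (R_scale H_a) C = RM.hclass 0"
      by (rule H01_map_R_scale_zero[of _ 1 0]) (use that in \<open>simp_all add: H_relations H_pos_basis(1)[symmetric]\<close>, simp add: H_pos_basis)
    show "RM.H01_map (R_scale (H_sigma (-4))) C = RM.hclass 0"
      by (rule H01_map_R_scale_zero[of _ 0 4, OF H_sigma4 _ _ that]) (simp_all add: H_sigma_def pos_def)
  qed
  have "RM.H01_concentrated_in TYPE('f) ({(n, 0) | n. True} \<union> {(n, -2) | n. True})"
    unfolding RM.H01_concentrated_in_def
  proof (intro conjI allI impI ballI)
    fix d :: roq assume d: "d \<notin> {(n, 0) | n. True} \<union> {(n, -2) | n. True}"
    have "gr d = {0 :: ('f tensor_A1_F, gens) tensor}"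
      using free_gr_outside[OF _ d] by (auto simp: gr_tensor_def F2.span_zero)
    then show "RM.H01_gr d = {RM.hclass (0 :: 'f R)}"
      using gr[of d] by (simp add: \<Phi>_def additive.zero[OF additive_gens_cycle])
  next
    fix C assume "C \<in> (RM.H01 :: 'f R set set)"
    then obtain t where t: "C = \<Phi> t" using bij by (auto simp: bij_betw_def)
    obtain T z where T: "finite T" "T \<subseteq> {(n, 0) | n. True} \<union> {(n, -2) | n. True}" "\<forall>d\<in>T. z d \<in> gr d" "t = (\<Sum>d\<in>T. z d)"
      using free_homogeneous_sum[of t] by blast
    have "gens_cycle t = (\<Sum>d\<in>T. gens_cycle (z d))"
      unfolding T(4) by (rule additive.sum[OF additive_gens_cycle])
    then show "\<exists>T z. finite T \<and> T \<subseteq> {(n, 0) | n. True} \<union> {(n, -2) | n. True} \<and>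
        (\<forall>d\<in>T. z d \<in> RM.cycles \<inter> gr d) \<and> C = RM.hclass (\<Sum>d\<in>T. z d)"
      using T gens_cycle_in_cycles gens_cycle_gr t by (intro exI[of _ T] exI[of _ "\<lambda>d. gens_cycle (z d)"]) (simp add: \<Phi>_def)
  qed
  then show ?thesis
    by (intro conjI exI[of _ \<Phi>] allI ballI bij add gr gens scale)
qed

end
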